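(* Let $M$ be a surface in $(\mathbb{R}^3,\|\cdot\|)$, with Minkowski Gaussian curvature $K$ and area element $\omega$, and let $M_\varepsilon$ be the $\varepsilon$-tube $$M_\varepsilon:=\{z\in\mathbb{R}^3:\mathrm{dist}(z,M)\le\varepsilon\},\qquad \mathrm{dist}(z,M)=\inf\{\|z-p\|:p\in M\}.$$ For sufficiently small $\varepsilon>0$, the volume of $M_\varepsilon$ is given by $$\mathrm{vol}(M_\varepsilon)=2\varepsilon\,\lambda_M(M)+\frac{2\varepsilon^3}{3}\int_M K\,\omega,$$ where $\mathrm{vol}$ is the usual volume of $\mathbb{R}^3$ (given by the determinant) and $\lambda_M(M)=\int_M\omega$.
   Context: $\|\cdot\|$ is a smooth and strictly convex norm on $\mathbb{R}^3$ with unit sphere $\partial B=\{x:\|x\|=1\}$; the usual (Euclidean) Gaussian curvature of the surface $\partial B$ is assumed to vanish nowhere. A vector $v$ is Birkhoff orthogonal to a plane $P\subseteq\mathbb{R}^3$ (through the origin) if $\|v\|\le\|v+tw\|$ for all $w\in P$, $t\in\mathbb{R}$. For an (orientable) surface $M$ immersed in $\mathbb{R}^3$, identified with its image, the Birkhoff-Gauss map $\eta:M\to\partial B$ is a smooth map such that $\eta(p)$ is Birkhoff orthogonal to $T_pM$ for each $p$. Since $T_{\eta(p)}\partial B=T_pM$ as linear planes, $d\eta_p$ is an endomorphism of $T_pM$, and the Minkowski Gaussian curvature is $K(p)=\det(d\eta_p)$. The area element on $M$ is $\omega(X,Y)=\det(X,Y,\eta)$ for tangent vectors $X,Y$, with $M$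 oriented so that $\omega$ is positive.
   Formalization: The surface M is taken to be nonempty, compact, embedded and without boundary; for arbitrary immersed surfaces the formula fails (e.g. a flat open disc has extra rim volume, and self-intersecting sheets overlap in the tube). *)

theory Defs
  imports "HOL-Analysis.Analysis"
begin

(* C^n on an open set S: all iterated directional derivatives up to order n exist
   (as Frechet derivatives) and are continuous. *)
fun Cn_on :: "nat \<Rightarrow> 'a::real_normed_vector set \<Rightarrow> ('a \<Rightarrow> 'b::real_normed_vector) \<Rightarrow> bool" where
  "Cn_on 0 S f \<longleftrightarrow> continuous_on S f"
| "Cn_on (Suc n) S f \<longleftrightarrow>
     (\<forall>x\<in>S. f differentiable at x) \<and> (\<forall>v. Cn_on n S (\<lambda>x. frechet_derivative f (at x) v))"

definition smooth_on :: "'a::real_normed_vector set \<Rightarrow> ('a \<Rightarrow> 'b::real_normed_vector) \<Rightarrow> bool" where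
  "smooth_on S f \<longleftrightarrow> (\<forall>n. Cn_on n S f)"

definition is_norm :: "(real^3 \<Rightarrow> real) \<Rightarrow> bool" where
  "is_norm N \<longleftrightarrow>
     (\<forall>x. 0 \<le> N x) \<and> (\<forall>x. N x = 0 \<longleftrightarrow> x = 0) \<and>
     (\<forall>a x. N (a *\<^sub>R x) = \<bar>a\<bar> * N x) \<and> (\<forall>x y. N (x + y) \<le> N x + N y)"

definition smooth_norm :: "(real^3 \<Rightarrow> real) \<Rightarrow> bool" where
  "smooth_norm N \<longleftrightarrow> smooth_on (- {0}) N"

definition strictly_convex_norm :: "(real^3 \<Rightarrow> real) \<Rightarrow> bool" where
  "strictly_convex_norm N \<longleftrightarrow>
     (\<forall>x y. N x = 1 \<longrightarrow> N y = 1 \<longrightarrow> x \<noteq> y \<longrightarrow> N (x + y) < 2)"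

definition unit_sphere :: "(real^3 \<Rightarrow> real) \<Rightarrow> (real^3) set" where
  "unit_sphere N = {x. N x = 1}"

definition birkhoff_orthogonal :: "(real^3 \<Rightarrow> real) \<Rightarrow> real^3 \<Rightarrow> (real^3) set \<Rightarrow> bool" where
  "birkhoff_orthogonal N v P \<longleftrightarrow> (\<forall>w\<in>P. \<forall>t. N v \<le> N (v + t *\<^sub>R w))"

definition local_param :: "(real^3) set \<Rightarrow> (real^2) set \<Rightarrow> (real^2 \<Rightarrow> real^3) \<Rightarrow> bool" where
  "local_param M U \<phi> \<longleftrightarrow>
     open U \<and> smooth_on U \<phi> \<and> openin (top_of_set M) (\<phi> ` U) \<and>
     (\<exists>\<psi>. homeomorphism U (\<phi> ` U) \<phi> \<psi>) \<and>
     (\<forall>u\<in>U. inj (frechet_derivative \<phi> (at u)))"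

(* A nonempty embedded smooth surface without boundary. *)
definition regular_surface :: "(real^3) set \<Rightarrow> bool" where
  "regular_surface M \<longleftrightarrow> M \<noteq> {} \<and> (\<forall>p\<in>M. \<exists>U \<phi>. local_param M U \<phi> \<and> p \<in> \<phi> ` U)"

definition smooth_on_surface :: "(real^3) set \<Rightarrow> (real^3 \<Rightarrow> real^3) \<Rightarrow> bool" where
  "smooth_on_surface M f \<longleftrightarrow> (\<forall>U \<phi>. local_param M U \<phi> \<longrightarrow> smooth_on U (f \<circ> \<phi>))"

definition curve_through ::
  "(real^3) set \<Rightarrow> real^3 \<Rightarrow> real^3 \<Rightarrow> (real \<Rightarrow> real^3) \<Rightarrow> bool" where
  "curve_through M p X \<gamma> \<longleftrightarrow>
     (\<exists>\<delta>>0. \<gamma> ` {-\<delta><..<\<delta>} \<subseteq> M) \<and> \<gamma> 0 = p \<and> (\<gamma> has_vector_derivative X) (at 0)"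

definition tangent_plane :: "(real^3) set \<Rightarrow> real^3 \<Rightarrow> (real^3) set" where
  "tangent_plane M p = {X. \<exists>\<gamma>. curve_through M p X \<gamma>}"

(* Meaningful for X in the tangent plane at p only. *)
definition surface_differential ::
  "(real^3) set \<Rightarrow> (real^3 \<Rightarrow> real^3) \<Rightarrow> real^3 \<Rightarrow> real^3 \<Rightarrow> real^3" where
  "surface_differential M f p X =
     (THE Y. \<forall>\<gamma>. curve_through M p X \<gamma> \<longrightarrow> ((f \<circ> \<gamma>) has_vector_derivative Y) (at 0))"

(* Determinant of an endomorphism L of a plane V, from its matrix in any basis x, y of V. *)
definition plane_det :: "(real^3) set \<Rightarrow> (real^3 \<Rightarrow> real^3) \<Rightarrow> real" where
  "plane_det V L =
     (THE d. \<exists>x y a b c e. x \<noteq> y \<and> independent {x, y} \<and> span {x, y} = V \<and>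
        L x = a *\<^sub>R x + b *\<^sub>R y \<and> L y = c *\<^sub>R x + e *\<^sub>R y \<and> d = a * e - b * c)"

(* For a Euclidean unit normal field xi this is the Gaussian curvature, for a
   Birkhoff-Gauss map xi the Minkowski Gaussian curvature. *)
definition curvature :: "(real^3) set \<Rightarrow> (real^3 \<Rightarrow> real^3) \<Rightarrow> real^3 \<Rightarrow> real" where
  "curvature M \<xi> p = plane_det (tangent_plane M p) (surface_differential M \<xi> p)"

definition euclidean_gauss_map :: "(real^3) set \<Rightarrow> (real^3 \<Rightarrow> real^3) \<Rightarrow> bool" where
  "euclidean_gauss_map M \<nu> \<longleftrightarrow>
     smooth_on_surface M \<nu> \<and>
     (\<forall>p\<in>M. norm (\<nu> p) = 1 \<and> (\<forall>w\<in>tangent_plane M p. \<nu> p \<bullet> w = 0))"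

(* Independent of the choice of the unit normal field, since the determinant on a plane
   is invariant under a change of sign of the endomorphism. *)
definition nonvanishing_gauss_curvature :: "(real^3) set \<Rightarrow> bool" where
  "nonvanishing_gauss_curvature S \<longleftrightarrow>
     (\<exists>\<nu>. euclidean_gauss_map S \<nu> \<and> (\<forall>p\<in>S. curvature S \<nu> p \<noteq> 0))"

definition birkhoff_gauss_map ::
  "(real^3 \<Rightarrow> real) \<Rightarrow> (real^3) set \<Rightarrow> (real^3 \<Rightarrow> real^3) \<Rightarrow> bool" where
  "birkhoff_gauss_map N M \<eta> \<longleftrightarrow>
     smooth_on_surface M \<eta> \<and>
     (\<forall>p\<in>M. \<eta> p \<in> unit_sphere N \<and> birkhoff_orthogonal N (\<eta> p) (tangent_plane M p))"

definition area_form :: "(real^3 \<Rightarrow> real^3) \<Rightarrow> real^3 \<Rightarrow> real^3 \<Rightarrow> real^3 \<Rightarrow> real" where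
  "area_form \<eta> p X Y = det (vector [X, Y, \<eta> p] :: real^3^3)"

(* The pullback of the area form along phi, as a density with respect to du1 du2. *)
definition area_density ::
  "(real^3 \<Rightarrow> real^3) \<Rightarrow> (real^2 \<Rightarrow> real^3) \<Rightarrow> real^2 \<Rightarrow> real" where
  "area_density \<eta> \<phi> u =
     area_form \<eta> (\<phi> u) (frechet_derivative \<phi> (at u) (axis 1 1))
                       (frechet_derivative \<phi> (at u) (axis 2 1))"

(* Parametrizations compatible with the orientation that makes the area form positive. *)
definition oriented_param ::
  "(real^3) set \<Rightarrow> (real^3 \<Rightarrow> real^3) \<Rightarrow> (real^2) set \<Rightarrow> (real^2 \<Rightarrow> real^3) \<Rightarrow> bool" where
  "oriented_param M \<eta> U \<phi> \<longleftrightarrow> local_param M U \<phi> \<and> (\<forall>u\<in>U. 0 < area_density \<eta> \<phi> u)"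

(* The Borel measure on M given by integration of the (positive) area form: the unique one
   that is computed in every oriented parametrization by integrating the pulled-back form.
   Integration of f times the area form over M is integration of f against it. *)
definition area_measure ::
  "(real^3) set \<Rightarrow> (real^3 \<Rightarrow> real^3) \<Rightarrow> (real^3) measure" where
  "area_measure M \<eta> =
     (THE \<mu>. sets \<mu> = sets (restrict_space borel M) \<and>
        (\<forall>U \<phi> A. oriented_param M \<eta> U \<phi> \<longrightarrow> A \<in> sets borel \<longrightarrow> A \<subseteq> U \<longrightarrow>
           emeasure \<mu> (\<phi> ` A) = (\<integral>\<^sup>+u\<in>A. ennreal (area_density \<eta> \<phi> u) \<partial>lborel)))"

definition norm_dist :: "(real^3 \<Rightarrow> real) \<Rightarrow> real^3 \<Rightarrow> (real^3) set \<Rightarrow> real" where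
  "norm_dist N z M = (INF p\<in>M. N (z - p))"

definition tube :: "(real^3 \<Rightarrow> real) \<Rightarrow> (real^3) set \<Rightarrow> real \<Rightarrow> (real^3) set" where
  "tube N M \<epsilon> = {z. norm_dist N z M \<le> \<epsilon>}"

end

theory Submission imports Defs begin

text \<open>
  Strict convexity and Birkhoff orthogonality identify the tube with the image of
  M x [-e, e] under F(p, t) = p + t eta(p), and F is injective for small e by compactness.
  In a chart the Jacobian of F is the area density times det(I + t d eta) = 1 + tH + t^2 K,
  so the volume of F(B x [-t, t]) is the integral of 2t + (2/3) t^3 K over B; the term in H
  is odd in t and cancels.

  The left-hand side does not mention charts. Hence, for one fixed small t, dividing the measure
  B -> vol F(B x [-t, t]) by 2t + (2/3) t^3 K yields a measure that has the prescribed density in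
  every chart. This shows that the area measure exists, without transition maps or gluing.
\<close>

section \<open>Smoothness\<close>

text \<open>\<open>area_measure\<close>, \<open>surface_differential\<close> and
  \<open>plane_det\<close> are definite descriptions, so nothing can be said about them before
  existence and uniqueness are settled; this shapes the proof more than the volume computation does.
  For the area measure the weight 2t + (2/3) t^3 K must stay away from 0 on M. Hence t is chosen
  with |t^2 K| <= 1, besides making F injective and its Jacobian nonnegative. The measure is built
  at one height \<delta>, but its chart densities do not involve \<delta>; uniqueness therefore
  recovers the measure of every thinner tube by putting the corresponding weight back, and comparing
  total masses gives the formula.

  The differential dN at \<open>\<eta> p\<close> takes the place of a Euclidean normal: it
  annihilates the tangent plane and the image of the differential of \<eta>, and takes the value 1
  at \<open>\<eta> p\<close>. This one functional makes the area form nondegenerate, turns the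
  differential of \<eta> into an endomorphism of the tangent plane, and singles out the direction
  from a nearest point of M.\<close>

lemma Cn_on_cong:
  assumes "open S" "\<And>x. x \<in> S \<Longrightarrow> f x = g x"
  shows "Cn_on n S f \<longleftrightarrow> Cn_on n S g"
  using assms(2)
proof (induction n arbitrary: f g)
  case 0
  then show ?case by (simp cong: continuous_on_cong)
next
  case (Suc n)
  \<comment> \<open>Openness makes agreement on S sufficient, since all derivatives here are taken
    in the full space.\<close>
  have ev: "(f has_derivative D) (at x) \<longleftrightarrow> (g has_derivative D) (at x)" if "x \<in> S" for x D
    using that Suc.prems assms(1) has_derivative_transform_within_open[of f D x UNIV S g]
      has_derivative_transform_within_open[of g D x UNIV S f]
    by auto
  then have "frechet_derivative f (at x) = frechet_derivative g (at x)" if "x \<in> S" for x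
    using that by (simp add: frechet_derivative_def)
  then have "Cn_on n S (\<lambda>x. frechet_derivative f (at x) v) \<longleftrightarrow> Cn_on n S (\<lambda>x. frechet_derivative g (at x) v)" for v
    by (intro Suc.IH) simp
  moreover have "f differentiable at x \<longleftrightarrow> g differentiable at x" if "x \<in> S" for x
    using ev[OF that] by (auto simp: differentiable_def)
  ultimately show ?case by simp
qed

lemma Cn_on_subset: "Cn_on n S f \<Longrightarrow> T \<subseteq> S \<Longrightarrow> Cn_on n T f"
  by (induction n arbitrary: f) (auto intro: continuous_on_subset)

lemma frechet_derivative_compose_linear:
  assumes "bounded_linear L" "f differentiable at (L x)"
  shows "frechet_derivative (f \<circ> L) (at x) v = frechet_derivative f (at (L x)) (L v)"
proof -
  have "(f \<circ> L has_derivative frechet_derivative f (at (L x)) \<circ> L) (at x)"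
    using assms by (intro diff_chain_at bounded_linear_imp_has_derivative)
      (auto simp: frechet_derivative_works)
  from frechet_derivative_at[OF this] show ?thesis by (metis comp_apply)
qed

text \<open>For linear L the chain rule returns a single directional derivative of f, in direction
  \<open>L v\<close>, composed with L. So the induction needs no product terms.\<close>

lemma Cn_on_compose_linear:
  assumes "bounded_linear L" "open S" "Cn_on n S f"
  shows "Cn_on n (L -` S) (f \<circ> L)"
  using assms(3)
proof (induction n arbitrary: f)
  case 0
  then show ?case
    using continuous_on_compose[of "L -` S" L f] linear_continuous_on[OF assms(1)]
    by (auto intro: continuous_on_subset)
next
  case (Suc n)
  have op: "open (L -` S)"
    using assms(1,2) by (intro continuous_open_vimage) (auto intro: linear_continuous_on linear_continuous_at)
  have diff: "f differentiable at (L x)" if "L x \<in> S" for x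
    using Suc.prems that by simp
  have "Cn_on n (L -` S) (\<lambda>x. frechet_derivative (f \<circ> L) (at x) v)" for v
  proof -
    have "Cn_on n (L -` S) ((\<lambda>y. frechet_derivative f (at y) (L v)) \<circ> L)"
      using Suc.prems by (intro Suc.IH) simp
    then show ?thesis
      by (rule Cn_on_cong[OF op, THEN iffD1, rotated])
        (simp add: frechet_derivative_compose_linear[OF assms(1) diff])
  qed
  moreover have "(f \<circ> L) differentiable at x" if "L x \<in> S" for x
    using diff[OF that] assms(1)
    by (intro differentiable_chain_at) (auto intro: bounded_linear_imp_differentiable)
  ultimately show ?case unfolding Cn_on.simps by blast
qed

lemma smooth_on_has_derivative:
  "smooth_on S f \<Longrightarrow> x \<in> S \<Longrightarrow> (f has_derivative frechet_derivative f (at x)) (at x)"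
  unfolding smooth_on_def using frechet_derivative_works by (metis Cn_on.simps(2))

lemma smooth_on_continuous_derivative:
  "smooth_on S f \<Longrightarrow> continuous_on S (\<lambda>x. frechet_derivative f (at x) v)"
  unfolding smooth_on_def by (metis Cn_on.simps)

lemma smooth_on_continuous: "smooth_on S f \<Longrightarrow> continuous_on S f"
  unfolding smooth_on_def by (metis Cn_on.simps(1))

lemma smooth_on_subset: "smooth_on S f \<Longrightarrow> T \<subseteq> S \<Longrightarrow> smooth_on T f"
  unfolding smooth_on_def using Cn_on_subset by blast

lemma smooth_on_compose_linear:
  "bounded_linear L \<Longrightarrow> open S \<Longrightarrow> smooth_on S f \<Longrightarrow> smooth_on (L -` S) (f \<circ> L)"
  unfolding smooth_on_def using Cn_on_compose_linear by blast

section \<open>Determinants\<close>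

abbreviation det3 :: "real^3 \<Rightarrow> real^3 \<Rightarrow> real^3 \<Rightarrow> real" where
  "det3 x y z \<equiv> det (vector [x, y, z] :: real^3^3)"

lemma det3_combination:
  "det3 (a *\<^sub>R x + b *\<^sub>R y) (c *\<^sub>R x + e *\<^sub>R y) z = (a * e - b * c) * det3 x y z"
  by (simp add: det_3 algebra_simps)

text \<open>Cramer's rule cleared of its denominator, hence a polynomial identity that needs no
  independence.\<close>

lemma det3_cramer:
  "det3 x y z *\<^sub>R v = det3 v y z *\<^sub>R x + det3 x v z *\<^sub>R y + det3 x y v *\<^sub>R z"
  by (simp add: vec_eq_iff forall_3 det_3 algebra_simps)

lemma continuous_on_det3 [continuous_intros]:
  assumes "continuous_on S f" "continuous_on S g" "continuous_on S h"
  shows "continuous_on S (\<lambda>x. det3 (f x) (g x) (h x))"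
  unfolding det_3 vector_3 by (intro continuous_intros assms)

text \<open>Applying D to a vanishing combination isolates the coefficient of z. In use, D is the
  differential of the norm at a value of the Birkhoff-Gauss map.\<close>

lemma det3_nonzero:
  assumes "linear D" "D x = 0" "D y = 0" "D z \<noteq> 0"
    and "\<And>a b. a *\<^sub>R x + b *\<^sub>R y = 0 \<Longrightarrow> a = 0 \<and> b = 0"
  shows "det3 x y z \<noteq> (0::real)"
proof -
  have "\<forall>i. c i = 0" if s: "(\<Sum>i\<in>UNIV. c i *s row i (vector [x, y, z] :: real^3^3)) = 0" for c :: "3 \<Rightarrow> real"
  proof -
    have *: "c 1 *\<^sub>R x + c 2 *\<^sub>R y + c 3 *\<^sub>R z = 0"
      using s by (simp add: sum_3 row_def vec_eq_iff)
    then have "D (c 1 *\<^sub>R x + c 2 *\<^sub>R y + c 3 *\<^sub>R z) = 0" by (simp add: linear_0[OF assms(1)])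
    then have "c 3 = 0" by (simp add: linear_add[OF assms(1)] linear_cmul[OF assms(1)] assms(2-4))
    with * assms(5)[of "c 1" "c 2"] show ?thesis by (simp add: forall_3)
  qed
  then have "invertible (vector [x, y, z] :: real^3^3)"
    unfolding invertible_right_inverse matrix_right_invertible_independent_rows by blast
  then show ?thesis by (simp add: invertible_det_nz)
qed

text \<open>D applied to Cramer's rule kills the terms in x and y and leaves the coefficient of z,
  which must therefore vanish.\<close>

lemma kernel_combination:
  assumes "linear D" "D x = 0" "D y = 0" "D z \<noteq> (0::real)" "det3 x y z \<noteq> 0" "D v = 0"
  obtains a b where "v = a *\<^sub>R x + b *\<^sub>R y"
proof -
  let ?d = "det3 x y z"
  have "?d * D v = det3 x y v * D z"
    using arg_cong[OF det3_cramer[of x y z v], of D] assms(2,3)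
    by (simp add: linear_add[OF assms(1)] linear_cmul[OF assms(1)])
  then have "det3 x y v = 0" using assms by simp
  then have "?d *\<^sub>R v = det3 v y z *\<^sub>R x + det3 x v z *\<^sub>R y" using det3_cramer[of x y z v] by simp
  then have "(1 / ?d) *\<^sub>R ?d *\<^sub>R v = (1 / ?d) *\<^sub>R (det3 v y z *\<^sub>R x + det3 x v z *\<^sub>R y)" by simp
  then show ?thesis using assms(5) that[of "det3 v y z / ?d" "det3 x v z / ?d"]
    by (simp add: scaleR_add_right)
qed

lemma independent_pair_iff:
  "x \<noteq> y \<and> independent {x, y} \<longleftrightarrow> (\<forall>a b. a *\<^sub>R x + b *\<^sub>R y = 0 \<longrightarrow> a = 0 \<and> b = (0::real))"
  (is "?l \<longleftrightarrow> ?r")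
proof
  assume l: ?l
  show ?r
  proof (intro allI impI)
    fix a b assume ab: "a *\<^sub>R x + b *\<^sub>R y = 0"
    let ?u = "\<lambda>v. if v = x then a else b"
    have "(\<Sum>v\<in>{x,y}. ?u v *\<^sub>R v) = 0" using ab l by (subst sum.insert) auto
    then have "\<forall>v\<in>{x,y}. ?u v = 0"
      using l independentD[of "{x,y}" "{x,y}" ?u] by blast
    then show "a = 0 \<and> b = 0" using l by (metis insertCI)
  qed
next
  assume r: ?r
  have ne: "x \<noteq> y" using r[rule_format, of 1 "-1"] by auto
  moreover have "u x = 0 \<and> u y = 0" if "(\<Sum>v\<in>{x,y}. u v *\<^sub>R v) = 0" for u
    using r[rule_format, of "u x" "u y"] that ne by simp
  then have "independent {x,y}" by (intro independent_if_scalars_zero) auto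
  ultimately show ?l by simp
qed

text \<open>Basis independence of the determinant, which the definite description in
  \<open>plane_det\<close> requires. Linearity is assumed on combinations of x and y only, because a
  surface differential has no meaning off the tangent plane.\<close>

lemma plane_det_eq:
  assumes "\<And>a b. a *\<^sub>R x + b *\<^sub>R y = 0 \<Longrightarrow> a = 0 \<and> b = 0" "span {x, y} = V"
    and lin: "\<And>r s. L (r *\<^sub>R x + s *\<^sub>R y) = r *\<^sub>R L x + s *\<^sub>R L y"
    and L: "L x = a *\<^sub>R x + b *\<^sub>R y" "L y = c *\<^sub>R x + e *\<^sub>R y"
  shows "plane_det V L = a * e - b * c"
  unfolding plane_det_def
proof (rule the_equality)
  show "\<exists>x y a' b' c' e'. x \<noteq> y \<and> independent {x, y} \<and> span {x, y} = V \<and>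
        L x = a' *\<^sub>R x + b' *\<^sub>R y \<and> L y = c' *\<^sub>R x + e' *\<^sub>R y \<and> a * e - b * c = a' * e' - b' * c'"
    using assms independent_pair_iff[of x y] by blast
next
  fix d
  assume "\<exists>x y a b c e. x \<noteq> y \<and> independent {x, y} \<and> span {x, y} = V \<and>
        L x = a *\<^sub>R x + b *\<^sub>R y \<and> L y = c *\<^sub>R x + e *\<^sub>R y \<and> d = a * e - b * c"
  then obtain x' y' a' b' c' e' where ind: "\<forall>a b. a *\<^sub>R x' + b *\<^sub>R y' = 0 \<longrightarrow> a = 0 \<and> b = 0"
    and sp: "span {x', y'} = V" and L': "L x' = a' *\<^sub>R x' + b' *\<^sub>R y'" "L y' = c' *\<^sub>R x' + e' *\<^sub>R y'"
    and d: "d = a' * e' - b' * c'"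
    using independent_pair_iff by metis
  have "x' \<in> span {x, y}" "y' \<in> span {x, y}"
    using sp assms(2) by (metis insertCI span_base)+
  then obtain p q r s where x': "x' = p *\<^sub>R x + q *\<^sub>R y" and y': "y' = r *\<^sub>R x + s *\<^sub>R y"
    unfolding span_insert span_singleton by (force simp: algebra_simps eq_diff_eq)
  have uniq: "\<alpha> = \<alpha>' \<and> \<beta> = \<beta>'" if "\<alpha> *\<^sub>R x + \<beta> *\<^sub>R y = \<alpha>' *\<^sub>R x + \<beta>' *\<^sub>R y" for \<alpha> \<beta> \<alpha>' \<beta>'
    using assms(1)[of "\<alpha> - \<alpha>'" "\<beta> - \<beta>'"] that by (simp add: algebra_simps)
  \<comment> \<open>The determinant of the change of basis.\<close>
  have nz: "p * s - q * r \<noteq> 0"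
  proof
    assume z: "p * s - q * r = 0"
    have "s *\<^sub>R x' + (-q) *\<^sub>R y' = (p * s - q * r) *\<^sub>R x" by (simp add: x' y' algebra_simps)
    then have "s = 0" "q = 0" using ind[rule_format, of s "-q"] z by auto
    have "r *\<^sub>R x' + (-p) *\<^sub>R y' = 0" by (simp add: x' y' \<open>s = 0\<close> \<open>q = 0\<close>)
    then have "p = 0" using ind[rule_format, of r "-p"] by auto
    then have "x' = 0" by (simp add: x' \<open>q = 0\<close>)
    then show False using ind[rule_format, of 1 0] by simp
  qed
  have "(p * a + q * c) *\<^sub>R x + (p * b + q * e) *\<^sub>R y = (a' * p + b' * r) *\<^sub>R x + (a' * q + b' * s) *\<^sub>R y"
    using L'(1) lin[of p q] by (simp add: x' y' L algebra_simps)
  then have 1: "p * a + q * c = a' * p + b' * r" "p * b + q * e = a' * q + b' * s" using uniq by blast+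
  have "(r * a + s * c) *\<^sub>R x + (r * b + s * e) *\<^sub>R y = (c' * p + e' * r) *\<^sub>R x + (c' * q + e' * s) *\<^sub>R y"
    using L'(2) lin[of r s] by (simp add: x' y' L algebra_simps)
  then have 2: "r * a + s * c = c' * p + e' * r" "r * b + s * e = c' * q + e' * s" using uniq by blast+
  \<comment> \<open>With P the change of basis and A, A' the two matrices, the equations in 1 and 2
    say P A = A' P. Taking determinants and cancelling det P finishes.\<close>
  have "(p * s - q * r) * (a * e - b * c) = (p * a + q * c) * (r * b + s * e) - (p * b + q * e) * (r * a + s * c)" 
    by (simp add: algebra_simps) 
  also have "\<dots> = (p * s - q * r) * (a' * e' - b' * c')"
    unfolding 1 2 by (simp add: algebra_simps)
  finally show "d = a * e - b * c" using d nz by simp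
qed

section \<open>Charts and tangent planes\<close>

abbreviation partial :: "2 \<Rightarrow> (real^2 \<Rightarrow> 'a::real_normed_vector) \<Rightarrow> real^2 \<Rightarrow> 'a" where
  "partial i f u \<equiv> frechet_derivative f (at u) (axis i 1)"

lemma frechet_derivative_partials:
  assumes "(f has_derivative frechet_derivative f (at u)) (at u)"
  shows "frechet_derivative f (at u) v = (v $ 1) *\<^sub>R partial 1 f u + (v $ 2) *\<^sub>R partial 2 f u"
proof -
  have v: "v = (v $ 1) *\<^sub>R axis 1 1 + (v $ 2) *\<^sub>R axis 2 1"
    by (simp add: vec_eq_iff forall_2 axis_def)
  have "frechet_derivative f (at u) v = frechet_derivative f (at u) ((v $ 1) *\<^sub>R axis 1 1 + (v $ 2) *\<^sub>R axis 2 1)"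
    by (rule arg_cong[OF v])
  also have "\<dots> = (v $ 1) *\<^sub>R partial 1 f u + (v $ 2) *\<^sub>R partial 2 f u"
    by (simp only: linear_add[OF has_derivative_linear[OF assms]] linear_cmul[OF has_derivative_linear[OF assms]])
  finally show ?thesis .
qed

lemma has_vector_derivative_compose:
  assumes "(f has_derivative D) (at (c t))" "(c has_vector_derivative v) (at t)"
  shows "((\<lambda>t. f (c t)) has_vector_derivative D v) (at t)"
proof -
  have "(f \<circ> c has_derivative D \<circ> (\<lambda>s. s *\<^sub>R v)) (at t)"
    using assms(2) unfolding has_vector_derivative_def by (intro diff_chain_at assms(1))
  then show ?thesis
    unfolding has_vector_derivative_def by (simp add: comp_def linear_cmul[OF has_derivative_linear[OF assms(1)]])
qed

lemma chart_has_derivative: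
  assumes "local_param M U \<phi>" "u \<in> U"
  shows "(\<phi> has_derivative frechet_derivative \<phi> (at u)) (at u)"
  using assms smooth_on_has_derivative unfolding local_param_def by blast

lemma chart_linear: "local_param M U \<phi> \<Longrightarrow> u \<in> U \<Longrightarrow> linear (frechet_derivative \<phi> (at u))"
  using chart_has_derivative has_derivative_linear by blast

lemma chart_subset: "local_param M U \<phi> \<Longrightarrow> \<phi> ` U \<subseteq> M"
  unfolding local_param_def by (meson openin_imp_subset)

text \<open>Curves in M lift differentiably to the parameter domain, so all first-order questions
  about M move into an open subset of the plane.\<close>

lemma chart_curve:
  assumes lp: "local_param M U \<phi>" and u: "u \<in> U" and \<gamma>: "curve_through M (\<phi> u) X \<gamma>"
  obtains c v \<delta> where "\<delta> > 0" "c 0 = u" "(c has_vector_derivative v) (at 0)"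
    "\<And>t. \<bar>t\<bar> < \<delta> \<Longrightarrow> c t \<in> U \<and> \<gamma> t = \<phi> (c t)" "X = frechet_derivative \<phi> (at u) v"
proof -
  obtain \<psi> where \<psi>: "homeomorphism U (\<phi> ` U) \<phi> \<psi>" using lp unfolding local_param_def by blast
  have \<psi>\<phi>: "\<psi> (\<phi> x) = x" if "x \<in> U" for x using \<psi> that by (meson homeomorphism_apply1)
  obtain W where W: "open W" "\<phi> ` U = M \<inter> W"
    using lp unfolding local_param_def openin_open by metis
  obtain \<delta>1 where \<delta>1: "\<delta>1 > 0" "\<gamma> ` {-\<delta>1<..<\<delta>1} \<subseteq> M" and \<gamma>0: "\<gamma> 0 = \<phi> u"
    and d\<gamma>: "(\<gamma> has_vector_derivative X) (at 0)"
    using \<gamma> unfolding curve_through_def by blast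
  have "isCont \<gamma> 0" using d\<gamma> has_vector_derivative_continuous by blast
  moreover have "\<gamma> 0 \<in> W" using W u \<gamma>0 by blast
  ultimately have "eventually (\<lambda>t. \<gamma> t \<in> W) (nhds 0)"
    using W(1) by (metis isCont_def tendsto_at_iff_tendsto_nhds topological_tendstoD)
  then obtain \<delta>2 where \<delta>2: "\<delta>2 > 0" "\<And>t. \<bar>t\<bar> < \<delta>2 \<Longrightarrow> \<gamma> t \<in> W"
    unfolding eventually_nhds_metric by auto
  define \<delta> where "\<delta> = min \<delta>1 \<delta>2"
  have \<delta>: "\<delta> > 0" "\<gamma> ` {-\<delta><..<\<delta>} \<subseteq> \<phi> ` U"
    using \<delta>1 \<delta>2 W unfolding \<delta>_def by (auto simp: image_subset_iff abs_less_iff)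
  let ?S = "{-\<delta><..<\<delta>}"
  have inj: "inj (frechet_derivative \<phi> (at u))" using lp u unfolding local_param_def by blast
  obtain L where L: "linear L" "L \<circ> frechet_derivative \<phi> (at u) = id"
    using linear_injective_left_inverse[OF chart_linear[OF lp u] inj] by blast
  \<comment> \<open>The inverse chart is given only as a continuous map on the image, which is not
    open in space. Its derivative exists within the image and equals a left inverse of the injective
    chart differential.\<close>
  have d\<psi>: "(\<psi> has_derivative L) (at (\<phi> u) within \<phi> ` U)"
  proof (rule has_derivative_inverse_within)
    show "(\<phi> has_derivative frechet_derivative \<phi> (at u)) (at u within U)"
      using chart_has_derivative[OF lp u] has_derivative_at_withinI by blast
    show "continuous (at (\<phi> u) within \<phi> ` U) \<psi>"
      using \<psi> u unfolding homeomorphism_def continuous_on_eq_continuous_within by blast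
  qed (fact u L \<psi>\<phi>)+
  have "(\<psi> \<circ> \<gamma> has_derivative L \<circ> (\<lambda>t. t *\<^sub>R X)) (at 0 within ?S)"
  proof (rule diff_chain_within)
    show "(\<gamma> has_derivative (\<lambda>t. t *\<^sub>R X)) (at 0 within ?S)"
      using d\<gamma> unfolding has_vector_derivative_def by (rule has_derivative_at_withinI)
    show "(\<psi> has_derivative L) (at (\<gamma> 0) within \<gamma> ` ?S)"
      unfolding \<gamma>0 by (rule has_derivative_subset[OF d\<psi> \<delta>(2)])
  qed
  moreover have "L \<circ> (\<lambda>t. t *\<^sub>R X) = (\<lambda>t. t *\<^sub>R L X)"
    by (rule ext) (simp add: linear_cmul[OF L(1)])
  ultimately have "((\<psi> \<circ> \<gamma>) has_vector_derivative L X) (at 0 within ?S)"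
    unfolding has_vector_derivative_def by metis
  then have dc: "((\<psi> \<circ> \<gamma>) has_vector_derivative L X) (at 0)"
    using \<delta>(1) has_vector_derivative_within_open[of 0 ?S] by auto
  have c: "(\<psi> \<circ> \<gamma>) t \<in> U \<and> \<gamma> t = \<phi> ((\<psi> \<circ> \<gamma>) t)" if "\<bar>t\<bar> < \<delta>" for t
  proof -
    have "\<gamma> t \<in> \<phi> ` U" using \<delta>(2) that by (auto simp: image_subset_iff abs_less_iff)
    then obtain x where x: "x \<in> U" "\<gamma> t = \<phi> x" by blast
    then show ?thesis using \<psi>\<phi>[OF x(1)] by simp
  qed
  have "((\<lambda>t. \<phi> ((\<psi> \<circ> \<gamma>) t)) has_vector_derivative frechet_derivative \<phi> (at u) (L X)) (at 0)"
    using chart_has_derivative[OF lp u] \<gamma>0 \<psi>\<phi>[OF u] by (intro has_vector_derivative_compose[OF _ dc]) simp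
  then have "(\<gamma> has_vector_derivative frechet_derivative \<phi> (at u) (L X)) (at 0)"
    by (rule has_vector_derivative_transform_within_open[of _ _ _ ?S]) (use \<delta>(1) c in \<open>auto simp: abs_less_iff\<close>)
  then have "X = frechet_derivative \<phi> (at u) (L X)"
    using d\<gamma> vector_derivative_unique_at by blast
  then show thesis using that[OF \<delta>(1) _ dc c] \<gamma>0 \<psi>\<phi>[OF u] by simp
qed

lemma straight_curve:
  assumes lp: "local_param M U \<phi>" and u: "u \<in> U"
  shows "curve_through M (\<phi> u) (frechet_derivative \<phi> (at u) v) (\<lambda>t. \<phi> (u + t *\<^sub>R v))"
proof -
  have "open U" using lp unfolding local_param_def by blast
  moreover have "((\<lambda>t. u + t *\<^sub>R v) \<longlongrightarrow> u + 0 *\<^sub>R v) (nhds 0)"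
    by (intro tendsto_intros filterlim_ident)
  ultimately have "eventually (\<lambda>t. u + t *\<^sub>R v \<in> U) (nhds 0)"
    using u by (intro topological_tendstoD) auto
  then obtain \<delta> where \<delta>: "\<delta> > 0" "\<And>t. \<bar>t\<bar> < \<delta> \<Longrightarrow> u + t *\<^sub>R v \<in> U"
    unfolding eventually_nhds_metric by auto
  then have "(\<lambda>t. \<phi> (u + t *\<^sub>R v)) ` {-\<delta><..<\<delta>} \<subseteq> M"
    using chart_subset[OF lp] by (force simp: abs_less_iff)
  moreover have "((\<lambda>t. \<phi> (u + t *\<^sub>R v)) has_vector_derivative frechet_derivative \<phi> (at u) v) (at 0)"
    using chart_has_derivative[OF lp u]
    by (intro has_vector_derivative_compose[where f = \<phi> and c = "\<lambda>t. u + t *\<^sub>R v"]) (auto simp: has_vector_derivative_def intro!: derivative_eq_intros)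
  ultimately show ?thesis unfolding curve_through_def using \<delta>(1) by auto
qed

lemma tangent_plane_chart:
  assumes "local_param M U \<phi>" "u \<in> U"
  shows "tangent_plane M (\<phi> u) = range (frechet_derivative \<phi> (at u))"
proof
  show "tangent_plane M (\<phi> u) \<subseteq> range (frechet_derivative \<phi> (at u))"
    unfolding tangent_plane_def using chart_curve[OF assms] by blast
  show "range (frechet_derivative \<phi> (at u)) \<subseteq> tangent_plane M (\<phi> u)"
    unfolding tangent_plane_def using straight_curve[OF assms] by blast
qed

text \<open>Curves with equal velocity lift to parameter curves with equal velocity, because the
  chart differential is injective; so the value does not depend on the curve. The image of a
  straight segment supplies a curve, hence uniqueness.\<close>

lemma surface_differential_chart:
  assumes lp: "local_param M U \<phi>" and u: "u \<in> U" and sm: "smooth_on U (f \<circ> \<phi>)"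
  shows "surface_differential M f (\<phi> u) (frechet_derivative \<phi> (at u) v) = frechet_derivative (f \<circ> \<phi>) (at u) v"
  unfolding surface_differential_def
proof (rule the_equality)
  have inj: "inj (frechet_derivative \<phi> (at u))" using lp u unfolding local_param_def by blast
  let ?d = "frechet_derivative (f \<circ> \<phi>) (at u)"
  have df: "((f \<circ> \<phi>) has_derivative ?d) (at u)" using sm u smooth_on_has_derivative by blast
  show *: "\<forall>\<gamma>. curve_through M (\<phi> u) (frechet_derivative \<phi> (at u) v) \<gamma> \<longrightarrow> ((f \<circ> \<gamma>) has_vector_derivative ?d v) (at 0)"
  proof (intro allI impI)
    fix \<gamma> assume "curve_through M (\<phi> u) (frechet_derivative \<phi> (at u) v) \<gamma>"
    from chart_curve[OF lp u this] obtain c v' \<delta> where \<delta>: "\<delta> > 0" "c 0 = u" "(c has_vector_derivative v') (at 0)"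
      "\<And>t. \<bar>t\<bar> < \<delta> \<Longrightarrow> c t \<in> U \<and> \<gamma> t = \<phi> (c t)"
      "frechet_derivative \<phi> (at u) v = frechet_derivative \<phi> (at u) v'" by blast
    have "v' = v" using \<delta>(5) inj by (simp add: inj_eq)
    then have "((\<lambda>t. (f \<circ> \<phi>) (c t)) has_vector_derivative ?d v) (at 0)"
      using df \<delta>(2,3) by (intro has_vector_derivative_compose[where f = "f \<circ> \<phi>" and c = c]) metis+
    then show "((f \<circ> \<gamma>) has_vector_derivative ?d v) (at 0)"
      by (rule has_vector_derivative_transform_within_open[of _ _ _ "{-\<delta><..<\<delta>}"])
        (use \<delta>(1,4) in \<open>auto simp: abs_less_iff\<close>)
  qed
  fix Y assume "\<forall>\<gamma>. curve_through M (\<phi> u) (frechet_derivative \<phi> (at u) v) \<gamma> \<longrightarrow> ((f \<circ> \<gamma>) has_vector_derivative Y) (at 0)"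
  then show "Y = ?d v" using * straight_curve[OF lp u, of v] vector_derivative_unique_at by blast
qed

section \<open>Supporting planes of the unit ball\<close>

locale smooth_strictly_convex_norm =
  fixes N :: "real^3 \<Rightarrow> real"
  assumes N_norm: "is_norm N" and N_smooth: "smooth_norm N" and N_strict: "strictly_convex_norm N"
begin

lemma N_nonneg: "0 \<le> N x" and N_eq_0_iff: "N x = 0 \<longleftrightarrow> x = 0"
  and N_scaleR: "N (a *\<^sub>R x) = \<bar>a\<bar> * N x" and N_triangle: "N (x + y) \<le> N x + N y"
  using N_norm unfolding is_norm_def by blast+

lemma N_minus: "N (- x) = N x"
  using N_scaleR[of "-1" x] by simp

lemma N_continuous: "continuous_on S N"
proof -
  have "convex_on UNIV N"
    by (rule convex_onI) (auto simp: N_scaleR intro: order_trans[OF N_triangle])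
  then show ?thesis
    using convex_on_continuous[of UNIV N] continuous_on_subset by blast
qed

lemma N_has_derivative: "x \<noteq> 0 \<Longrightarrow> (N has_derivative frechet_derivative N (at x)) (at x)"
  using N_smooth smooth_on_has_derivative unfolding smooth_norm_def by blast

lemma N_linear: "x \<noteq> 0 \<Longrightarrow> linear (frechet_derivative N (at x))"
  using N_has_derivative has_derivative_linear by blast

lemma N_line_has_derivative:
  assumes "x \<noteq> 0"
  shows "((\<lambda>t. N (x + t *\<^sub>R y)) has_field_derivative frechet_derivative N (at x) y) (at 0)"
proof -
  have "((\<lambda>t. N (x + t *\<^sub>R y)) has_vector_derivative frechet_derivative N (at x) y) (at 0)"
    using N_has_derivative[OF assms]
    by (intro has_vector_derivative_compose[where f = N and c = "\<lambda>t. x + t *\<^sub>R y"]) (auto simp: has_vector_derivative_def intro!: derivative_eq_intros)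
  then show ?thesis by (simp add: has_real_derivative_iff_has_vector_derivative)
qed

text \<open>The triangle inequality bounds the right difference quotients. Together with symmetry
  this says that the differential of the norm has dual norm at most 1.\<close>

lemma N_derivative_le:
  assumes "x \<noteq> 0"
  shows "frechet_derivative N (at x) y \<le> N y"
proof (rule tendsto_upperbound)
  show "((\<lambda>t. (N (x + t *\<^sub>R y) - N x) / t) \<longlongrightarrow> frechet_derivative N (at x) y) (at_right 0)"
    using N_line_has_derivative[OF assms, of y] by (auto simp: DERIV_def intro: filterlim_mono at_le)
  have "(N (x + t *\<^sub>R y) - N x) / t \<le> N y" if "t > 0" for t
    using N_triangle[of x "t *\<^sub>R y"] that by (simp add: N_scaleR field_simps)
  then show "\<forall>\<^sub>F t in at_right 0. (N (x + t *\<^sub>R y) - N x) / t \<le> N y"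
    using eventually_at_right_less[of "0::real"] by (auto elim: eventually_mono)
qed auto

lemma N_derivative_abs_le: "x \<noteq> 0 \<Longrightarrow> \<bar>frechet_derivative N (at x) y\<bar> \<le> N y"
  using N_derivative_le[of x y] N_derivative_le[of x "- y"] N_minus[of y] linear_neg[OF N_linear]
  by (auto simp: abs_le_iff)

text \<open>Euler's identity for a function homogeneous of degree 1.\<close>

lemma N_derivative_self:
  assumes "x \<noteq> 0"
  shows "frechet_derivative N (at x) x = N x"
proof (rule antisym[OF N_derivative_le[OF assms]])
  have "((\<lambda>t. (1 + t) * N x) has_field_derivative frechet_derivative N (at x) x) (at 0)"
  proof (rule DERIV_cong_ev[THEN iffD1, OF refl _ refl N_line_has_derivative[OF assms, of x]])
    have "N (x + t *\<^sub>R x) = (1 + t) * N x" if "t > -1" for t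
      using N_scaleR[of "1 + t" x] that by (simp add: algebra_simps)
    moreover have "\<forall>\<^sub>F t in nhds 0. t > (-1::real)"
      using eventually_nhds_in_open[of "{-1<..}" "0::real"] by simp
    ultimately show "\<forall>\<^sub>F t in nhds 0. N (x + t *\<^sub>R x) = (1 + t) * N x"
      by (rule eventually_mono[rotated])
  qed
  moreover have "((\<lambda>t. (1 + t) * N x) has_field_derivative N x) (at 0)"
    by (auto intro!: derivative_eq_intros)
  ultimately show "N x \<le> frechet_derivative N (at x) x" using DERIV_unique by fastforce
qed

text \<open>Birkhoff orthogonality makes t = 0 a minimum of the norm along each line through v in a
  direction of P.\<close>

lemma birkhoff_orthogonal_derivative:
  assumes "birkhoff_orthogonal N v P" "v \<noteq> 0" "w \<in> P"
  shows "frechet_derivative N (at v) w = 0"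
  by (rule DERIV_local_min[OF N_line_has_derivative[OF assms(2), of w], of 1])
    (use assms in \<open>auto simp: birkhoff_orthogonal_def\<close>)

text \<open>First variation of the distance: along a curve in M through the nearest point p, the
  distance to z has a minimum at time 0. It is differentiable there because z - p is
  nonzero.\<close>

lemma nearest_point_derivative:
  assumes "\<And>q. q \<in> M \<Longrightarrow> N (z - p) \<le> N (z - q)" "z \<noteq> p" "X \<in> tangent_plane M p"
  shows "frechet_derivative N (at (z - p)) X = 0"
proof -
  obtain \<gamma> \<delta> where \<gamma>: "\<delta> > 0" "\<gamma> ` {-\<delta><..<\<delta>} \<subseteq> M" "\<gamma> 0 = p" "(\<gamma> has_vector_derivative X) (at 0)"
    using assms(3) unfolding tangent_plane_def curve_through_def by blast
  let ?D = "frechet_derivative N (at (z - p))"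
  have nz: "z - p \<noteq> 0" using assms(2) by simp
  have "((\<lambda>t. N (z - \<gamma> t)) has_vector_derivative ?D (- X)) (at 0)"
    using N_has_derivative[OF nz] \<gamma>(3,4)
    by (intro has_vector_derivative_compose[where f = N and c = "\<lambda>t. z - \<gamma> t"]) (auto intro!: derivative_eq_intros)
  then have "((\<lambda>t. N (z - \<gamma> t)) has_field_derivative - ?D X) (at 0)"
    by (simp add: has_real_derivative_iff_has_vector_derivative linear_neg[OF N_linear[OF nz]])
  then have "- ?D X = 0"
  proof (rule DERIV_local_min[OF _ \<gamma>(1)])
    show "\<forall>t. \<bar>0 - t\<bar> < \<delta> \<longrightarrow> N (z - \<gamma> 0) \<le> N (z - \<gamma> t)"
      using assms(1) \<gamma>(2,3) by (auto simp: image_subset_iff abs_less_iff)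
  qed
  then show ?thesis by simp
qed

text \<open>
  The mutual bounds \<open>\<bar>DN\<^sub>w v\<bar> \<le> N v\<close> and \<open>\<bar>DN\<^sub>v w\<bar> \<le> N w\<close> are forced to be equalities, so the
  segment between the normalised vectors lies on the unit sphere.
\<close>

lemma common_kernel_parallel:
  assumes w: "N w = 1" and v: "v \<noteq> 0"
    and Dw: "frechet_derivative N (at w) x = 0" "frechet_derivative N (at w) y = 0"
    and Dv: "frechet_derivative N (at v) x = 0" "frechet_derivative N (at v) y = 0"
    and d: "det3 x y w \<noteq> 0"
  shows "v = N v *\<^sub>R w \<or> v = - N v *\<^sub>R w"
proof -
  let ?Dw = "frechet_derivative N (at w)" and ?Dv = "frechet_derivative N (at v)"
  have w0: "w \<noteq> 0" using w N_eq_0_iff[of w] by auto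
  have lw: "linear ?Dw" and lv: "linear ?Dv" using w0 v N_linear by blast+
  have Dww: "?Dw w = 1" using N_derivative_self[OF w0] w by simp
  have Nv: "N v > 0" using v N_eq_0_iff[of v] N_nonneg[of v] by linarith
  define \<alpha> where "\<alpha> = ?Dw v"
  have "?Dw (v - \<alpha> *\<^sub>R w) = 0" by (simp add: linear_diff[OF lw] linear_cmul[OF lw] \<alpha>_def Dww)
  then obtain a b where ab: "v - \<alpha> *\<^sub>R w = a *\<^sub>R x + b *\<^sub>R y"
    using kernel_combination[OF lw Dw _ d] Dww by (metis zero_neq_one)
  have "?Dv (v - \<alpha> *\<^sub>R w) = 0" unfolding ab by (simp add: linear_add[OF lv] linear_cmul[OF lv] Dv)
  then have "N v = \<alpha> * ?Dv w"
    using N_derivative_self[OF v] by (simp add: linear_diff[OF lv] linear_cmul[OF lv])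
  then have "N v = \<bar>\<alpha>\<bar> * \<bar>?Dv w\<bar>" using Nv by (metis abs_mult abs_of_pos)
  also have "\<dots> \<le> \<bar>\<alpha>\<bar> * 1"
    using N_derivative_abs_le[OF v, of w] w by (intro mult_left_mono) auto
  finally have "\<bar>\<alpha>\<bar> = N v" using N_derivative_abs_le[OF w0, of v] unfolding \<alpha>_def by simp
  \<comment> \<open>Dividing by the signed \<alpha> instead of \<open>N v\<close> puts v' on the
    same side of the kernel of \<open>?Dw\<close> as w.\<close>
  define v' where "v' = (1 / \<alpha>) *\<^sub>R v"
  have \<alpha>0: "\<alpha> \<noteq> 0" using \<open>\<bar>\<alpha>\<bar> = N v\<close> Nv by auto
  have "N v' = 1" unfolding v'_def using \<open>\<bar>\<alpha>\<bar> = N v\<close> Nv by (simp add: N_scaleR)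
  have "?Dw v' = 1" unfolding v'_def using \<alpha>0 by (simp add: linear_cmul[OF lw] flip: \<alpha>_def)
  then have "2 \<le> N (v' + w)"
    using N_derivative_le[OF w0, of "v' + w"] by (simp add: linear_add[OF lw] Dww)
  then have "v' = w" using N_strict \<open>N v' = 1\<close> w unfolding strictly_convex_norm_def by force
  then have "v = \<alpha> *\<^sub>R w" unfolding v'_def using \<alpha>0 by auto
  moreover have "\<alpha> = N v \<or> \<alpha> = - N v" using \<open>\<bar>\<alpha>\<bar> = N v\<close> by linarith
  ultimately show ?thesis by metis
qed

end

text \<open>Chart images are open in M, so continuity near a point can be tested after composing
  with a chart.\<close>

lemma continuous_on_charts:
  assumes M: "regular_surface M"
    and f: "\<And>U \<phi>. local_param M U \<phi> \<Longrightarrow> continuous_on U (f \<circ> \<phi>)"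
  shows "continuous_on M f"
  unfolding continuous_on_eq_continuous_within
proof
  fix p assume "p \<in> M"
  then obtain U \<phi> where lp: "local_param M U \<phi>" and p: "p \<in> \<phi> ` U"
    using M unfolding regular_surface_def by blast
  obtain \<psi> where \<psi>: "homeomorphism U (\<phi> ` U) \<phi> \<psi>" using lp unfolding local_param_def by blast
  obtain W where W: "open W" "\<phi> ` U = M \<inter> W"
    using lp unfolding local_param_def openin_open by metis
  have "continuous_on (\<phi> ` U) ((f \<circ> \<phi>) \<circ> \<psi>)"
    using \<psi> f[OF lp] unfolding homeomorphism_def by (metis continuous_on_compose)
  then have "continuous_on (\<phi> ` U) f"
    by (rule continuous_on_eq) (use \<psi> in \<open>auto simp: homeomorphism_def\<close>)
  then have "continuous (at p within \<phi> ` U) f"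
    using p unfolding continuous_on_eq_continuous_within by blast
  moreover have "at p within \<phi> ` U = at p within M"
    by (rule at_within_nhd[of _ W]) (use p W in auto)
  ultimately show "continuous (at p within M) f" by (simp add: continuous_within)
qed

text \<open>Pairs (u, t) of a parameter and a height are encoded in \<open>real^3\<close>, so that
  the shift map has a square Jacobian matrix.\<close>

definition prj :: "real^3 \<Rightarrow> real^2" where "prj x = vector [x $ 1, x $ 2]"

lemma prj_nth [simp]: "prj x $ 1 = x $ 1" "prj x $ 2 = x $ 2"
  by (simp_all add: prj_def)

lemma bounded_linear_prj: "bounded_linear prj"
  unfolding linear_conv_bounded_linear[symmetric]
  by (rule linearI) (simp_all add: vec_eq_iff forall_2)

lemma prj_axis [simp]: "prj (axis 1 1) = axis 1 1" "prj (axis 2 1) = axis 2 1" "prj (axis 3 1) = 0"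
  by (simp_all add: vec_eq_iff forall_2 axis_def)

lemma det_matrix_columns: "det (matrix f :: real^3^3) = det3 (f (axis 1 1)) (f (axis 2 1)) (f (axis 3 1))"
  unfolding det_3 by (simp add: matrix_def)

section \<open>The Birkhoff-Gauss map in charts\<close>

locale minkowski_surface = smooth_strictly_convex_norm +
  fixes M :: "(real^3) set" and \<eta> :: "real^3 \<Rightarrow> real^3"
  assumes M_regular: "regular_surface M" and M_compact: "compact M"
    and \<eta>_birkhoff: "birkhoff_gauss_map N M \<eta>"
begin

lemma N_eta: "p \<in> M \<Longrightarrow> N (\<eta> p) = 1"
  using \<eta>_birkhoff unfolding birkhoff_gauss_map_def unit_sphere_def by auto

lemma eta_nonzero: "p \<in> M \<Longrightarrow> \<eta> p \<noteq> 0"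
  using N_eta N_eq_0_iff[of "\<eta> p"] by auto

lemma obtain_chart:
  assumes "p \<in> M"
  obtains U \<phi> u where "local_param M U \<phi>" "u \<in> U" "p = \<phi> u"
  using assms M_regular unfolding regular_surface_def by blast

lemma eta_chart_smooth: "local_param M U \<phi> \<Longrightarrow> smooth_on U (\<eta> \<circ> \<phi>)"
  using \<eta>_birkhoff unfolding birkhoff_gauss_map_def smooth_on_surface_def by blast

lemma eta_continuous: "continuous_on M \<eta>"
  using continuous_on_charts[OF M_regular] eta_chart_smooth smooth_on_continuous by blast

lemma eta_annihilates_tangent:
  assumes "p \<in> M" "X \<in> tangent_plane M p"
  shows "frechet_derivative N (at (\<eta> p)) X = 0"
  using assms \<eta>_birkhoff eta_nonzero birkhoff_orthogonal_derivative
  unfolding birkhoff_gauss_map_def by blast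

context
  fixes U \<phi> u
  assumes lp: "local_param M U \<phi>" and u: "u \<in> U"
begin

lemma chart_in_M: "\<phi> u \<in> M"
  using chart_subset[OF lp] u by blast

lemma eta_chart_has_derivative: "(\<eta> \<circ> \<phi> has_derivative frechet_derivative (\<eta> \<circ> \<phi>) (at u)) (at u)"
  using eta_chart_smooth[OF lp] u smooth_on_has_derivative by blast

lemma DN_chart: "frechet_derivative N (at (\<eta> (\<phi> u))) (frechet_derivative \<phi> (at u) v) = 0"
  using eta_annihilates_tangent[OF chart_in_M] tangent_plane_chart[OF lp u] by blast

text \<open>The map \<eta> has constant norm 1; differentiate that equation. This is the
  identification of the tangent plane of the unit sphere at \<open>\<eta> p\<close> with that of M
  at p, which makes the differential of \<eta> an endomorphism.\<close>

lemma DN_eta_chart: "frechet_derivative N (at (\<eta> (\<phi> u))) (frechet_derivative (\<eta> \<circ> \<phi>) (at u) v) = 0"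
proof -
  have nz: "\<eta> (\<phi> u) \<noteq> 0" using eta_nonzero chart_in_M by blast
  have "(N \<circ> (\<eta> \<circ> \<phi>) has_derivative
      frechet_derivative N (at (\<eta> (\<phi> u))) \<circ> frechet_derivative (\<eta> \<circ> \<phi>) (at u)) (at u)"
    using N_has_derivative[OF nz] by (intro diff_chain_at eta_chart_has_derivative) simp
  then have "((\<lambda>_. 1) has_derivative
      frechet_derivative N (at (\<eta> (\<phi> u))) \<circ> frechet_derivative (\<eta> \<circ> \<phi>) (at u)) (at u)"
  proof (rule has_derivative_transform_within_open)
    show "open U" using lp unfolding local_param_def by blast
    show "(N \<circ> (\<eta> \<circ> \<phi>)) x = 1" if "x \<in> U" for x
      using chart_subset[OF lp] that N_eta by auto
  qed (use u in auto)
  then have "frechet_derivative N (at (\<eta> (\<phi> u))) \<circ> frechet_derivative (\<eta> \<circ> \<phi>) (at u) = (\<lambda>_. 0)"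
    using has_derivative_const has_derivative_unique by blast
  then show ?thesis by (metis comp_apply)
qed

lemma partials_independent:
  assumes "a *\<^sub>R partial 1 \<phi> u + b *\<^sub>R partial 2 \<phi> u = 0"
  shows "a = 0 \<and> b = 0"
proof -
  let ?v = "vector [a, b] :: real^2"
  have "frechet_derivative \<phi> (at u) ?v = 0"
    using assms frechet_derivative_partials[OF chart_has_derivative[OF lp u], of ?v] by simp
  then have "?v = 0"
    using lp u linear_injective_0[OF chart_linear[OF lp u]] unfolding local_param_def by blast
  then show ?thesis by (simp add: vec_eq_iff forall_2)
qed

lemma area_density_det3: "area_density \<eta> \<phi> u = det3 (partial 1 \<phi> u) (partial 2 \<phi> u) (\<eta> (\<phi> u))"
  unfolding area_density_def area_form_def ..

text \<open>The differential of the norm at \<open>\<eta> (\<phi> u)\<close> vanishes on the tangent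
  plane and is 1 at \<open>\<eta> (\<phi> u)\<close>, so \<eta> is transversal to M.\<close>

lemma area_density_nonzero: "area_density \<eta> \<phi> u \<noteq> 0"
proof -
  have nz: "\<eta> (\<phi> u) \<noteq> 0" using eta_nonzero chart_in_M by blast
  show ?thesis unfolding area_density_det3
    by (rule det3_nonzero[OF N_linear[OF nz]])
      (use DN_chart N_derivative_self[OF nz] N_eta[OF chart_in_M] partials_independent in auto)
qed

lemma tangent_plane_span: "span {partial 1 \<phi> u, partial 2 \<phi> u} = tangent_plane M (\<phi> u)"
proof -
  let ?D = "frechet_derivative \<phi> (at u)"
  have "range ?D = ?D ` span {axis 1 1, axis 2 1}"
  proof -
    have "v \<in> span {axis 1 1, axis 2 1}" for v :: "real^2"
    proof -
      have "(v $ 1) *\<^sub>R axis 1 1 + (v $ 2) *\<^sub>R axis 2 1 \<in> span {axis 1 1, axis 2 1 :: real^2}"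
        by (intro span_add span_scale span_base) auto
      moreover have "(v $ 1) *\<^sub>R axis 1 1 + (v $ 2) *\<^sub>R axis 2 1 = v"
        by (simp add: vec_eq_iff forall_2 axis_def)
      ultimately show ?thesis by simp
    qed
    then show ?thesis by blast
  qed
  then show ?thesis
    unfolding tangent_plane_chart[OF lp u] using linear_span_image[OF chart_linear[OF lp u], of "{axis 1 1, axis 2 1}"]
    by simp
qed


end

end

section \<open>The Minkowski curvature as a Jacobian\<close>

context minkowski_surface
begin

text \<open>
  Being intrinsic, this determinant and its coefficient of \<open>t\<close> are continuous on the compact
  surface, which gives one bound on admissible \<open>t\<close> for all charts at once.
\<close>

definition tangent_jacobian :: "real^3 \<Rightarrow> real \<Rightarrow> real \<Rightarrow> real" where
  "tangent_jacobian p r s =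
     plane_det (tangent_plane M p) (\<lambda>X. r *\<^sub>R X + s *\<^sub>R surface_differential M \<eta> p X)"

text \<open>\<open>DN_eta_chart\<close> places the partial derivatives of \<eta> in the kernel of
  dN, which is spanned by the partial derivatives of the chart. The matrix is fixed before r and s,
  so one choice serves the curvature, the trace and the Jacobian of the shift.\<close>

lemma tangent_jacobian_coefficients:
  assumes lp: "local_param M U \<phi>" and u: "u \<in> U"
  obtains a b c e where
    "partial 1 (\<eta> \<circ> \<phi>) u = a *\<^sub>R partial 1 \<phi> u + b *\<^sub>R partial 2 \<phi> u"
    "partial 2 (\<eta> \<circ> \<phi>) u = c *\<^sub>R partial 1 \<phi> u + e *\<^sub>R partial 2 \<phi> u"
    "\<And>r s. tangent_jacobian (\<phi> u) r s = (r + s * a) * (r + s * e) - (s * b) * (s * c)"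
proof -
  let ?D = "frechet_derivative N (at (\<eta> (\<phi> u)))"
  have pM: "\<phi> u \<in> M" using chart_in_M[OF lp u] .
  have nz: "\<eta> (\<phi> u) \<noteq> 0" using eta_nonzero[OF pM] .
  have D1: "?D (\<eta> (\<phi> u)) \<noteq> 0" using N_derivative_self[OF nz] N_eta[OF pM] by simp
  have d: "det3 (partial 1 \<phi> u) (partial 2 \<phi> u) (\<eta> (\<phi> u)) \<noteq> 0"
    using area_density_nonzero[OF lp u] area_density_det3[OF lp u] by simp
  note comb = kernel_combination[OF N_linear[OF nz] DN_chart[OF lp u] DN_chart[OF lp u] D1 d DN_eta_chart[OF lp u]]
  obtain a b where ab: "partial 1 (\<eta> \<circ> \<phi>) u = a *\<^sub>R partial 1 \<phi> u + b *\<^sub>R partial 2 \<phi> u"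
    using comb by blast
  obtain c e where ce: "partial 2 (\<eta> \<circ> \<phi>) u = c *\<^sub>R partial 1 \<phi> u + e *\<^sub>R partial 2 \<phi> u"
    using comb by blast
  note sd = surface_differential_chart[OF lp u eta_chart_smooth[OF lp]]
  have "tangent_jacobian (\<phi> u) r s = (r + s * a) * (r + s * e) - (s * b) * (s * c)" for r s
    unfolding tangent_jacobian_def
  proof (rule plane_det_eq[OF _ tangent_plane_span[OF lp u]])
    let ?L = "\<lambda>X. r *\<^sub>R X + s *\<^sub>R surface_differential M \<eta> (\<phi> u) X"
    show "?L (x *\<^sub>R partial 1 \<phi> u + y *\<^sub>R partial 2 \<phi> u) = x *\<^sub>R ?L (partial 1 \<phi> u) + y *\<^sub>R ?L (partial 2 \<phi> u)" for x y
    proof -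
      have "x *\<^sub>R partial 1 \<phi> u + y *\<^sub>R partial 2 \<phi> u = frechet_derivative \<phi> (at u) (vector [x, y])"
        using frechet_derivative_partials[OF chart_has_derivative[OF lp u], of "vector [x, y]"] by simp
      then have "surface_differential M \<eta> (\<phi> u) (x *\<^sub>R partial 1 \<phi> u + y *\<^sub>R partial 2 \<phi> u)
          = frechet_derivative (\<eta> \<circ> \<phi>) (at u) (vector [x, y])" by (simp only: sd)
      also have "\<dots> = x *\<^sub>R partial 1 (\<eta> \<circ> \<phi>) u + y *\<^sub>R partial 2 (\<eta> \<circ> \<phi>) u"
        using frechet_derivative_partials[OF eta_chart_has_derivative[OF lp u], of "vector [x, y]"] by simp
      finally show ?thesis by (simp add: sd algebra_simps)
    qed
    show "?L (partial 1 \<phi> u) = (r + s * a) *\<^sub>R partial 1 \<phi> u + (s * b) *\<^sub>R partial 2 \<phi> u"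
      by (simp add: sd ab algebra_simps)
    show "?L (partial 2 \<phi> u) = (s * c) *\<^sub>R partial 1 \<phi> u + (r + s * e) *\<^sub>R partial 2 \<phi> u"
      by (simp add: sd ce algebra_simps)
  qed (use partials_independent[OF lp u] in blast)
  with ab ce show thesis using that by blast
qed

text \<open>The determinant of an endomorphism of the plane is the factor by which it scales the
  area form, the third vector being held fixed.\<close>

lemma tangent_jacobian_area_density:
  assumes lp: "local_param M U \<phi>" and u: "u \<in> U"
  shows "tangent_jacobian (\<phi> u) r s * area_density \<eta> \<phi> u =
    det3 (r *\<^sub>R partial 1 \<phi> u + s *\<^sub>R partial 1 (\<eta> \<circ> \<phi>) u)
      (r *\<^sub>R partial 2 \<phi> u + s *\<^sub>R partial 2 (\<eta> \<circ> \<phi>) u) (\<eta> (\<phi> u))"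
proof -
  obtain a b c e where
    1: "partial 1 (\<eta> \<circ> \<phi>) u = a *\<^sub>R partial 1 \<phi> u + b *\<^sub>R partial 2 \<phi> u"
    and 2: "partial 2 (\<eta> \<circ> \<phi>) u = c *\<^sub>R partial 1 \<phi> u + e *\<^sub>R partial 2 \<phi> u"
    and 3: "\<And>r s. tangent_jacobian (\<phi> u) r s = (r + s * a) * (r + s * e) - (s * b) * (s * c)"
    using tangent_jacobian_coefficients[OF lp u] by blast
  have "r *\<^sub>R partial 1 \<phi> u + s *\<^sub>R partial 1 (\<eta> \<circ> \<phi>) u = (r + s * a) *\<^sub>R partial 1 \<phi> u + (s * b) *\<^sub>R partial 2 \<phi> u"
    "r *\<^sub>R partial 2 \<phi> u + s *\<^sub>R partial 2 (\<eta> \<circ> \<phi>) u = (s * c) *\<^sub>R partial 1 \<phi> u + (r + s * e) *\<^sub>R partial 2 \<phi> u"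
    by (simp_all add: 1 2 algebra_simps)
  then show ?thesis
    by (simp only: det3_combination 3 area_density_det3[OF lp u])
qed

lemma curvature_eq: "curvature M \<eta> p = tangent_jacobian p 0 1"
  unfolding curvature_def tangent_jacobian_def by simp

text \<open>Without the customary factor 1/2: this is the trace of the differential of the Gauss map.\<close>

definition mean_curvature :: "real^3 \<Rightarrow> real" where
  "mean_curvature p = tangent_jacobian p 1 1 - 1 - curvature M \<eta> p"

text \<open>In a chart the determinant is a quadratic in t with constant term 1 and leading
  coefficient K, so its value at t = 1 reveals the middle coefficient.\<close>

lemma tangent_jacobian_polynomial:
  assumes "p \<in> M"
  shows "tangent_jacobian p 1 t = 1 + t * mean_curvature p + t\<^sup>2 * curvature M \<eta> p"
proof -
  obtain U \<phi> u where lp: "local_param M U \<phi>" "u \<in> U" and p: "p = \<phi> u" using obtain_chart[OF assms] .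
  obtain a b c e where
    "partial 1 (\<eta> \<circ> \<phi>) u = a *\<^sub>R partial 1 \<phi> u + b *\<^sub>R partial 2 \<phi> u"
    "partial 2 (\<eta> \<circ> \<phi>) u = c *\<^sub>R partial 1 \<phi> u + e *\<^sub>R partial 2 \<phi> u"
    and J: "\<And>r s. tangent_jacobian (\<phi> u) r s = (r + s * a) * (r + s * e) - (s * b) * (s * c)"
    using tangent_jacobian_coefficients[OF lp] by blast
  show ?thesis
    unfolding p mean_curvature_def curvature_eq J by (simp add: algebra_simps power2_eq_square)
qed

lemma area_density_continuous:
  assumes lp: "local_param M U \<phi>"
  shows "continuous_on U (area_density \<eta> \<phi>)"
proof -
  have "continuous_on U (\<eta> \<circ> \<phi>)" "continuous_on U (partial i \<phi>)" for i
    using smooth_on_continuous[OF eta_chart_smooth[OF lp]] lp smooth_on_continuous_derivative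
    unfolding local_param_def by blast+
  then have "continuous_on U (\<lambda>u. det3 (partial 1 \<phi> u) (partial 2 \<phi> u) (\<eta> (\<phi> u)))"
    by (intro continuous_on_det3) (auto simp: comp_def)
  then show ?thesis
    by (rule continuous_on_eq) (simp add: area_density_det3[OF lp])
qed

text \<open>In a chart this is a quotient of two continuous determinants with nonzero
  denominator.\<close>

lemma tangent_jacobian_continuous: "continuous_on M (\<lambda>p. tangent_jacobian p r s)"
proof (rule continuous_on_charts[OF M_regular])
  fix U \<phi> assume lp: "local_param M U \<phi>"
  have *: "continuous_on U (\<eta> \<circ> \<phi>)" "continuous_on U (partial i \<phi>)" "continuous_on U (partial i (\<eta> \<circ> \<phi>))" for i
    using smooth_on_continuous[OF eta_chart_smooth[OF lp]] lp smooth_on_continuous_derivative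
      eta_chart_smooth[OF lp] unfolding local_param_def by blast+
  have "continuous_on U (\<lambda>u. det3 (r *\<^sub>R partial 1 \<phi> u + s *\<^sub>R partial 1 (\<eta> \<circ> \<phi>) u)
      (r *\<^sub>R partial 2 \<phi> u + s *\<^sub>R partial 2 (\<eta> \<circ> \<phi>) u) ((\<eta> \<circ> \<phi>) u) / area_density \<eta> \<phi> u)"
    using area_density_nonzero[OF lp]
    by (intro continuous_on_divide continuous_on_det3 continuous_on_add continuous_on_scaleR
        continuous_on_const area_density_continuous[OF lp] *) auto
  then show "continuous_on U ((\<lambda>p. tangent_jacobian p r s) \<circ> \<phi>)"
    by (rule continuous_on_eq)
      (simp add: tangent_jacobian_area_density[OF lp, symmetric] area_density_nonzero[OF lp])
qed

lemma curvature_continuous: "continuous_on M (curvature M \<eta>)"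
  using tangent_jacobian_continuous[of 0 1] by (simp add: curvature_eq)

lemma mean_curvature_continuous: "continuous_on M mean_curvature"
  unfolding mean_curvature_def
  by (intro continuous_intros tangent_jacobian_continuous curvature_continuous)

lemma small_radius:
  obtains \<delta> where "\<delta> > 0" "\<And>p t. p \<in> M \<Longrightarrow> \<bar>t\<bar> \<le> \<delta> \<Longrightarrow> tangent_jacobian p 1 t \<ge> 0"
    "\<And>p t. p \<in> M \<Longrightarrow> \<bar>t\<bar> \<le> \<delta> \<Longrightarrow> \<bar>t\<^sup>2 * curvature M \<eta> p\<bar> \<le> 1"
proof -
  have "bounded (curvature M \<eta> ` M)" "bounded (mean_curvature ` M)"
    using curvature_continuous mean_curvature_continuous M_compact
    by (simp_all add: compact_continuous_image compact_imp_bounded)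
  then obtain A B where A: "A > 0" "\<And>p. p \<in> M \<Longrightarrow> \<bar>curvature M \<eta> p\<bar> \<le> A"
    and B: "B > 0" "\<And>p. p \<in> M \<Longrightarrow> \<bar>mean_curvature p\<bar> \<le> B"
    unfolding bounded_pos by auto
  \<comment> \<open>As \<delta> <= 1, also t^2 <= \<delta>. The terms in K and H are then at most
    \<delta> A and \<delta> B, which add up to at most 1 and cannot outweigh the constant
    term.\<close>
  define \<delta> where "\<delta> = 1 / (1 + A + B)"
  have \<delta>_pos: "\<delta> > 0" "\<delta> * (1 + A + B) = 1" using A(1) B(1) by (auto simp: \<delta>_def)
  moreover have "\<delta> * A > 0" "\<delta> * B > 0" using \<delta>_pos(1) A(1) B(1) by simp_all
  ultimately have \<delta>: "\<delta> > 0" "\<delta> \<le> 1" "\<delta> * A + \<delta> * B \<le> 1" "\<delta> * A \<le> 1"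
    unfolding distrib_left by linarith+
  have bK: "\<bar>t\<^sup>2 * curvature M \<eta> p\<bar> \<le> \<delta> * A" if "p \<in> M" "\<bar>t\<bar> \<le> \<delta>" for p t
  proof -
    have "\<bar>t\<bar> * \<bar>t\<bar> \<le> \<delta> * 1" using that \<delta> by (intro mult_mono) auto
    then show ?thesis unfolding abs_mult power2_eq_square
      using A(2)[OF that(1)] \<delta>(1) by (intro mult_mono) auto
  qed
  show thesis
  proof
    fix p t assume p: "p \<in> M" and t: "\<bar>t\<bar> \<le> \<delta>"
    have "\<bar>t * mean_curvature p\<bar> \<le> \<delta> * B"
      unfolding abs_mult using B(2)[OF p] t \<delta>(1) by (intro mult_mono) auto
    then show "tangent_jacobian p 1 t \<ge> 0"
      using bK[OF p t] \<delta>(3) unfolding tangent_jacobian_polynomial[OF p] by linarith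
    show "\<bar>t\<^sup>2 * curvature M \<eta> p\<bar> \<le> 1" using bK[OF p t] \<delta>(4) by linarith
  qed (rule \<delta>(1))
qed

section \<open>The tube as image of the normal shift\<close>

definition normal_shift :: "(real^3) \<times> real \<Rightarrow> real^3" where
  "normal_shift = (\<lambda>(p, t). p + t *\<^sub>R \<eta> p)"

lemma normal_shift_continuous: "continuous_on (M \<times> T) normal_shift"
proof -
  have "continuous_on (M \<times> T) (\<lambda>x. \<eta> (fst x))"
    by (rule continuous_on_compose2[OF eta_continuous]) (auto intro: continuous_intros)
  then show ?thesis
    unfolding normal_shift_def split_def by (intro continuous_intros)
qed

text \<open>Compactness attains the distance at some p, and both dN at z - p and dN at
  \<open>\<eta> p\<close> annihilate the tangent plane there; \<open>common_kernel_parallel\<close>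
  then makes z - p a multiple of \<open>\<eta> p\<close>. Conversely, z = p + t
  \<open>\<eta> p\<close> has distance at most |t| because \<eta> has norm 1.\<close>

lemma tube_eq:
  assumes "\<epsilon> > 0"
  shows "tube N M \<epsilon> = normal_shift ` (M \<times> {-\<epsilon>..\<epsilon>})"
proof (intro equalityI subsetI)
  have Mne: "M \<noteq> {}" using M_regular unfolding regular_surface_def by blast
  fix z
  {
    assume "z \<in> tube N M \<epsilon>"
    then have d: "norm_dist N z M \<le> \<epsilon>" unfolding tube_def by simp
    have "continuous_on M (\<lambda>q. N (z - q))"
      by (rule continuous_on_compose2[OF N_continuous[of UNIV]]) (auto intro: continuous_intros)
    then obtain p where p: "p \<in> M" "\<And>q. q \<in> M \<Longrightarrow> N (z - p) \<le> N (z - q)"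
      using continuous_attains_inf[OF M_compact Mne] by metis
    have "N (z - p) \<le> norm_dist N z M" unfolding norm_dist_def using Mne p(2) by (intro cINF_greatest)
    then have le: "N (z - p) \<le> \<epsilon>" using d by simp
    show "z \<in> normal_shift ` (M \<times> {-\<epsilon>..\<epsilon>})"
    \<comment> \<open>The norm is not differentiable at 0, so points of M itself are treated
      apart.\<close>
    proof (cases "z = p")
      case True
      then show ?thesis using p(1) assms by (intro image_eqI[of _ _ "(p, 0)"]) (auto simp: normal_shift_def)
    next
      case False
      obtain U \<phi> u where lp: "local_param M U \<phi>" "u \<in> U" and pu: "p = \<phi> u" using obtain_chart[OF p(1)] .
      have "frechet_derivative N (at (z - p)) (frechet_derivative \<phi> (at u) v) = 0" for v
        using nearest_point_derivative[OF p(2) False] tangent_plane_chart[OF lp] pu by blast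
      then have "z - p = N (z - p) *\<^sub>R \<eta> p \<or> z - p = - N (z - p) *\<^sub>R \<eta> p"
        using False area_density_nonzero[OF lp] unfolding area_density_det3[OF lp]
        by (intro common_kernel_parallel[of _ _ "partial 1 \<phi> u" "partial 2 \<phi> u"] N_eta p(1))
          (auto simp: pu DN_chart[OF lp])
      \<comment> \<open>The two signs are the two sides of M.\<close>
      then obtain t where t: "\<bar>t\<bar> = N (z - p)" "z - p = t *\<^sub>R \<eta> p" using N_nonneg[of "z - p"] by (metis abs_minus_cancel abs_of_nonneg)
      have "z = normal_shift (p, t)" using t(2) by (simp add: normal_shift_def algebra_simps)
      then show ?thesis using p(1) t(1) le by (intro image_eqI[of _ _ "(p, t)"]) auto
    qed
  next
    assume "z \<in> normal_shift ` (M \<times> {-\<epsilon>..\<epsilon>})"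
    then obtain p t where "p \<in> M" "-\<epsilon> \<le> t" "t \<le> \<epsilon>" and z: "z = p + t *\<^sub>R \<eta> p"
      unfolding normal_shift_def by auto
    then have p: "p \<in> M" "\<bar>t\<bar> \<le> \<epsilon>" by auto
    have "norm_dist N z M \<le> N (z - p)"
      unfolding norm_dist_def using p(1) N_nonneg by (intro cINF_lower bdd_belowI2[of _ 0])
    then show "z \<in> tube N M \<epsilon>" unfolding tube_def using p z by (simp add: N_scaleR N_eta)
  }
qed

end

section \<open>Injectivity of the normal shift\<close>

context minkowski_surface
begin

definition chart_shift :: "(real^2 \<Rightarrow> real^3) \<Rightarrow> real^3 \<Rightarrow> real^3" where
  "chart_shift \<phi> x = normal_shift (\<phi> (prj x), x $ 3)"

definition chart_shift_deriv :: "(real^2 \<Rightarrow> real^3) \<Rightarrow> real^3 \<Rightarrow> real^3 \<Rightarrow> real^3" where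
  "chart_shift_deriv \<phi> x v = frechet_derivative \<phi> (at (prj x)) (prj v)
     + ((x $ 3) *\<^sub>R frechet_derivative (\<eta> \<circ> \<phi>) (at (prj x)) (prj v) + (v $ 3) *\<^sub>R \<eta> (\<phi> (prj x)))"

lemma chart_shift_has_derivative:
  assumes lp: "local_param M U \<phi>" and x: "prj x \<in> U"
  shows "(chart_shift \<phi> has_derivative chart_shift_deriv \<phi> x) (at x)"
proof -
  have P: "(prj has_derivative prj) (at x)"
    by (rule bounded_linear_imp_has_derivative[OF bounded_linear_prj])
  have 1: "((\<lambda>x. \<phi> (prj x)) has_derivative (\<lambda>v. frechet_derivative \<phi> (at (prj x)) (prj v))) (at x)"
    using diff_chain_at[OF P chart_has_derivative[OF lp x]] by (simp add: comp_def)
  have 2: "((\<lambda>x. \<eta> (\<phi> (prj x))) has_derivative (\<lambda>v. frechet_derivative (\<eta> \<circ> \<phi>) (at (prj x)) (prj v))) (at x)"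
    using diff_chain_at[OF P eta_chart_has_derivative[OF lp x]] by (simp add: comp_def)
  have 3: "((\<lambda>x. x $ 3) has_derivative (\<lambda>v. v $ 3)) (at x)"
    by (rule bounded_linear_imp_has_derivative[OF bounded_linear_vec_nth])
  show ?thesis
    unfolding chart_shift_def chart_shift_deriv_def normal_shift_def split_conv
    using has_derivative_add[OF 1 has_derivative_scaleR[OF 3 2]] by (simp add: add.commute add.left_commute)
qed

text \<open>The first two columns are the partial derivatives of \<phi> + t \<eta> and the third is
  \<eta>, so this is the scaling of the area form with r = 1 and s = t.\<close>

lemma det_chart_shift_deriv:
  assumes lp: "local_param M U \<phi>" and x: "prj x \<in> U"
  shows "det (matrix (chart_shift_deriv \<phi> x)) = tangent_jacobian (\<phi> (prj x)) 1 (x $ 3) * area_density \<eta> \<phi> (prj x)"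
proof -
  have 0: "frechet_derivative \<phi> (at (prj x)) 0 = 0" "frechet_derivative (\<eta> \<circ> \<phi>) (at (prj x)) 0 = 0"
    using chart_linear[OF lp x] has_derivative_linear[OF eta_chart_has_derivative[OF lp x]] linear_0 by blast+
  have "(axis 1 1 :: real^3) $ 3 = 0" "(axis 2 1 :: real^3) $ 3 = 0" "(axis 3 1 :: real^3) $ 3 = 1"
    by (simp_all add: axis_def)
  then show ?thesis
    unfolding tangent_jacobian_area_density[OF lp x] det_matrix_columns chart_shift_deriv_def
    by (simp add: 0)
qed

lemma chart_shift_deriv_continuous:
  assumes lp: "local_param M U \<phi>"
  shows "continuous_on {x. prj x \<in> U} (\<lambda>x. chart_shift_deriv \<phi> x v)"
proof -
  have P: "continuous_on {x. prj x \<in> U} prj"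
    by (rule linear_continuous_on[OF bounded_linear_prj])
  have c: "continuous_on {x. prj x \<in> U} (\<lambda>x. f (prj x))" if "continuous_on U f" for f :: "real^2 \<Rightarrow> real^3"
    by (rule continuous_on_compose2[OF that P]) auto
  have "continuous_on U (\<lambda>u. frechet_derivative \<phi> (at u) (prj v))"
    "continuous_on U (\<lambda>u. frechet_derivative (\<eta> \<circ> \<phi>) (at u) (prj v))"
    using lp smooth_on_continuous_derivative eta_chart_smooth[OF lp] unfolding local_param_def by blast+
  moreover have "continuous_on U (\<lambda>u. \<eta> (\<phi> u))"
    using smooth_on_continuous[OF eta_chart_smooth[OF lp]] by (simp add: comp_def)
  ultimately show ?thesis
    unfolding chart_shift_deriv_def by (intro continuous_intros c)
qed

lemma open_prj_vimage: "open U \<Longrightarrow> open {x. prj x \<in> U}"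
  using continuous_open_vimage[of U prj] linear_continuous_at[OF bounded_linear_prj]
  by (auto simp: vimage_def)

text \<open>At height 0 the Jacobian reduces to the area density, which is nonzero; the injectivity
  half of the inverse function theorem applies.\<close>

lemma chart_shift_locally_injective:
  assumes lp: "local_param M U \<phi>" and a: "prj a \<in> U" "a $ 3 = 0"
  obtains r where "r > 0" "ball a r \<subseteq> {x. prj x \<in> U}" "inj_on (chart_shift \<phi>) (ball a r)"
proof -
  let ?S = "{x. prj x \<in> U}" and ?G = "chart_shift_deriv \<phi>"
  have oS: "open ?S" using lp unfolding local_param_def by (blast intro: open_prj_vimage)
  have bl: "bounded_linear (?G x)" if "x \<in> ?S" for x
    using has_derivative_bounded_linear[OF chart_shift_has_derivative[OF lp]] that by blast
  have "\<phi> (prj a) \<in> M" using chart_in_M[OF lp a(1)] .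
  then have "det (matrix (?G a)) \<noteq> 0"
    using det_chart_shift_deriv[OF lp a(1)] area_density_nonzero[OF lp a(1)] a(2)
      tangent_jacobian_polynomial[of "\<phi> (prj a)" 0] by simp
  then have "inj (?G a)"
    using det_nz_iff_inj[of "?G a"] bl a(1) by (simp add: linear_conv_bounded_linear)
  then obtain L where L: "linear L" "L \<circ> ?G a = id"
    using linear_injective_left_inverse[of "?G a"] bl a(1) by (auto simp: linear_conv_bounded_linear)
  \<comment> \<open>Continuity of the derivative in operator norm: in finite dimension it follows
    from continuity on each basis vector, the sum of those norms dominating the operator
    norm.\<close>
  have "\<exists>d>0. \<forall>x. dist a x < d \<longrightarrow> onorm (\<lambda>v. ?G x v - ?G a v) < e" if "e > 0" for e
  proof -
    let ?h = "\<lambda>x. \<Sum>i\<in>Basis. norm (?G x i - ?G a i)"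
    have "continuous_on ?S ?h"
      by (intro continuous_intros chart_shift_deriv_continuous[OF lp])
    then have "isCont ?h a" using oS a(1) by (simp add: continuous_on_eq_continuous_at)
    then have "(?h \<longlongrightarrow> ?h a) (nhds a)"
      using tendsto_at_iff_tendsto_nhds[of ?h a] by (simp only: isCont_def)
    then have "eventually (\<lambda>x. ?h x < e) (nhds a)"
      using that by (intro order_tendstoD(2)) auto
    moreover have "eventually (\<lambda>x. x \<in> ?S) (nhds a)" using oS a(1) by (intro eventually_nhds_in_open) auto
    ultimately have "eventually (\<lambda>x. onorm (\<lambda>v. ?G x v - ?G a v) < e) (nhds a)"
    proof eventually_elim
      case (elim x)
      then have "onorm (\<lambda>v. ?G x v - ?G a v) \<le> ?h x"
        using bl a(1) by (intro onorm_componentwise bounded_linear_sub) auto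
      then show ?case using elim by linarith
    qed
    then show ?thesis unfolding eventually_nhds_metric by (simp add: dist_commute)
  qed
  then show thesis
    using has_derivative_locally_injective[of a ?S L ?G "chart_shift \<phi>"] that oS a(1) L
      chart_shift_has_derivative[OF lp] by (auto simp: linear_conv_bounded_linear)
qed

lemma normal_shift_locally_injective:
  assumes "p \<in> M"
  obtains W \<delta> where "open W" "p \<in> W" "\<delta> > 0" "inj_on normal_shift ((M \<inter> W) \<times> {-\<delta>..\<delta>})"
proof -
  obtain U \<phi> u where lp: "local_param M U \<phi>" and u: "u \<in> U" and p: "p = \<phi> u" using obtain_chart[OF assms] .
  obtain \<psi> where \<psi>: "homeomorphism U (\<phi> ` U) \<phi> \<psi>" using lp unfolding local_param_def by blast
  define lift where "lift v t = (vector [v $ 1, v $ 2, t] :: real^3)" for v :: "real^2" and t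
  have lift: "prj (lift v t) = v" "lift v t $ 3 = t" for v t
    by (simp_all add: lift_def vec_eq_iff forall_2)
  obtain r where r: "r > 0" "ball (lift u 0) r \<subseteq> {x. prj x \<in> U}" "inj_on (chart_shift \<phi>) (ball (lift u 0) r)"
    using chart_shift_locally_injective[OF lp, of "lift u 0"] u lift by metis
  \<comment> \<open>Three coordinate differences below r/3 keep the 1-norm, and so the Euclidean
    distance, below r.\<close>
  have lift_ball: "lift v t \<in> ball (lift u 0) r" if "dist u v < r / 3" "\<bar>t\<bar> < r / 3" for v t
  proof -
    have "dist (lift u 0) (lift v t) \<le> (\<Sum>i\<in>UNIV. \<bar>(lift u 0 - lift v t) $ i\<bar>)"
      unfolding dist_norm by (rule norm_le_l1_cart)
    also have "\<dots> = \<bar>(u - v) $ 1\<bar> + \<bar>(u - v) $ 2\<bar> + \<bar>t\<bar>" by (simp add: sum_3 lift_def)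
    also have "\<dots> \<le> dist u v + dist u v + \<bar>t\<bar>"
      unfolding dist_norm by (intro add_mono component_le_norm_cart order_refl)
    finally show ?thesis using that by simp
  qed
  have "openin (top_of_set (\<phi> ` U)) (\<phi> ` U \<inter> \<psi> -` ball u (r / 3))"
    using \<psi> by (intro continuous_openin_preimage_gen) (auto simp: homeomorphism_def)
  then have "openin (top_of_set M) (\<phi> ` U \<inter> \<psi> -` ball u (r / 3))"
    using lp openin_trans unfolding local_param_def by blast
  then obtain W where W: "open W" "\<phi> ` U \<inter> \<psi> -` ball u (r / 3) = M \<inter> W"
    unfolding openin_open by blast
  show thesis
  proof
    show "p \<in> W" using W(2) u p \<psi> r(1) by (auto simp: homeomorphism_def)
    have *: "\<exists>v. q = \<phi> v \<and> dist u v < r / 3" if "q \<in> M \<inter> W" for q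
      using that \<psi> unfolding W(2)[symmetric] by (auto simp: homeomorphism_def)
    \<comment> \<open>The closed interval of radius r/4 sits inside the open one of radius
      r/3.\<close>
    show "inj_on normal_shift ((M \<inter> W) \<times> {- (r / 4)..r / 4})"
    proof (rule inj_onI, clarify)
      fix q1 t1 q2 t2 assume q: "q1 \<in> M" "q1 \<in> W" "q2 \<in> M" "q2 \<in> W"
        and t: "t1 \<in> {- (r / 4)..r / 4}" "t2 \<in> {- (r / 4)..r / 4}"
        and eq: "normal_shift (q1, t1) = normal_shift (q2, t2)"
      obtain v1 v2 where v: "q1 = \<phi> v1" "dist u v1 < r / 3" "q2 = \<phi> v2" "dist u v2 < r / 3"
        using * q by blast
      have "\<bar>t1\<bar> < r / 3" "\<bar>t2\<bar> < r / 3" using t r(1) by auto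
      then have "lift v1 t1 \<in> ball (lift u 0) r" "lift v2 t2 \<in> ball (lift u 0) r"
        using lift_ball v by blast+
      moreover have "chart_shift \<phi> (lift v1 t1) = chart_shift \<phi> (lift v2 t2)"
        using eq v unfolding chart_shift_def lift by simp
      ultimately have "lift v1 t1 = lift v2 t2" using r(3) by (meson inj_onD)
      then show "q1 = q2 \<and> t1 = t2" using lift v by metis
    qed
  qed (use W r in auto)
qed

text \<open>Local injectivity alone does not rule out a collision of segments based at distant
  points. If the shifts of (p, t) and (q, s) coincide, then p and q are so close that they share one
  set of a finite cover, where local injectivity decides.\<close>

lemma normal_shift_injective:
  obtains \<delta> where "\<delta> > 0" "inj_on normal_shift (M \<times> {-\<delta>..\<delta>})"
proof -
  have "\<exists>W \<delta>. open W \<and> p \<in> W \<and> \<delta> > 0 \<and> inj_on normal_shift ((M \<inter> W) \<times> {-\<delta>..\<delta>})" if "p \<in> M" for p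
    using normal_shift_locally_injective[OF that] by metis
  then obtain W \<delta> where W: "\<And>p. p \<in> M \<Longrightarrow> open (W p)" "\<And>p. p \<in> M \<Longrightarrow> p \<in> W p"
    and \<delta>: "\<And>p. p \<in> M \<Longrightarrow> \<delta> p > (0::real)" "\<And>p. p \<in> M \<Longrightarrow> inj_on normal_shift ((M \<inter> W p) \<times> {-\<delta> p..\<delta> p})"
    by metis
  obtain C where C: "C \<subseteq> M" "finite C" "M \<subseteq> (\<Union>c\<in>C. W c)"
    using compactE_image[OF M_compact, of M W] W by blast
  \<comment> \<open>A Lebesgue number of the cover.\<close>
  obtain \<rho> where \<rho>: "\<rho> > 0" "\<And>x. x \<in> M \<Longrightarrow> \<exists>G\<in>W ` C. ball x \<rho> \<subseteq> G"
    using Heine_Borel_lemma[OF M_compact, of "W ` C"] C W(1) by blast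
  have "bounded (\<eta> ` M)"
    using M_compact eta_continuous by (intro compact_imp_bounded compact_continuous_image)
  then obtain B where B: "B > 0" "\<And>p. p \<in> M \<Longrightarrow> norm (\<eta> p) \<le> B" unfolding bounded_pos by auto
  \<comment> \<open>Colliding base points are at distance at most 2 \<epsilon> B, and \<epsilon> <=
    \<rho>/(3B) brings this to at most 2\<rho>/3 < \<rho>.\<close>
  define \<epsilon> where "\<epsilon> = Min (insert (\<rho> / (3 * B)) (\<delta> ` C))"
  have \<epsilon>: "\<epsilon> > 0" "\<epsilon> \<le> \<rho> / (3 * B)" "\<And>c. c \<in> C \<Longrightarrow> \<epsilon> \<le> \<delta> c"
    unfolding \<epsilon>_def using C \<rho>(1) B(1) \<delta>(1) by auto
  show thesis
  proof
    show "inj_on normal_shift (M \<times> {-\<epsilon>..\<epsilon>})"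
    proof (rule inj_onI)
      fix x y assume x: "x \<in> M \<times> {-\<epsilon>..\<epsilon>}" and y: "y \<in> M \<times> {-\<epsilon>..\<epsilon>}" and eq: "normal_shift x = normal_shift y"
      obtain p t q s where xy: "x = (p, t)" "y = (q, s)" by (metis surj_pair)
      have pq: "p \<in> M" "q \<in> M" "\<bar>t\<bar> \<le> \<epsilon>" "\<bar>s\<bar> \<le> \<epsilon>" using x y xy by auto
      have "p - q - (s *\<^sub>R \<eta> q - t *\<^sub>R \<eta> p) = normal_shift x - normal_shift y"
        by (simp add: xy normal_shift_def)
      then have "dist p q = norm (s *\<^sub>R \<eta> q - t *\<^sub>R \<eta> p)" using eq by (simp add: dist_norm)
      also have "\<dots> \<le> \<bar>s\<bar> * norm (\<eta> q) + \<bar>t\<bar> * norm (\<eta> p)"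
        by (metis norm_scaleR norm_triangle_ineq4)
      also have "\<dots> \<le> \<epsilon> * B + \<epsilon> * B"
        using pq B \<epsilon>(1) by (intro add_mono mult_mono) auto
      also have "\<dots> < \<rho>"
        using mult_right_mono[OF \<epsilon>(2), of "2 * B"] B(1) \<rho>(1) by (simp add: field_simps)
      finally have "q \<in> ball p \<rho>" by simp
      then obtain c where c: "c \<in> C" "q \<in> W c" "p \<in> W c" using \<rho>(2)[OF pq(1)] \<rho>(1) by (metis centre_in_ball imageE subsetD)
      then have "\<bar>t\<bar> \<le> \<delta> c" "\<bar>s\<bar> \<le> \<delta> c" using pq \<epsilon>(3) by force+
      then have "x \<in> (M \<inter> W c) \<times> {-\<delta> c..\<delta> c}" "y \<in> (M \<inter> W c) \<times> {-\<delta> c..\<delta> c}"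
        using c pq xy by auto
      then show "x = y" using \<delta>(2)[of c] c(1) C(1) eq by (meson inj_onD subsetD)
    qed
  qed (rule \<epsilon>(1))
qed

end

section \<open>Volume over a chart\<close>

lemma prod_Basis_cart: "(\<Prod>b\<in>(Basis :: (real^'n) set). f b) = (\<Prod>i\<in>UNIV. f (axis i 1))"
proof -
  have "(Basis :: (real^'n) set) = range (\<lambda>i. axis i 1)" by (auto simp: Basis_vec_def)
  moreover have "inj (\<lambda>i::'n. axis i (1::real) :: real^'n)" by (auto simp: inj_def axis_eq_axis)
  ultimately have "bij_betw (\<lambda>i. axis i 1) UNIV (Basis :: (real^'n) set)"
    unfolding bij_betw_def by metis
  then show ?thesis by (rule prod.reindex_bij_betw[symmetric])
qed

lemma prod_3: "(\<Prod>i\<in>(UNIV :: 3 set). f i) = f 1 * f 2 * f 3"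
  unfolding UNIV_3 by (simp add: mult.assoc)

definition join :: "(real^2) \<times> real \<Rightarrow> real^3" where
  "join = (\<lambda>(u, t). (u $ 1) *\<^sub>R axis 1 1 + (u $ 2) *\<^sub>R axis 2 1 + t *\<^sub>R axis 3 1)"

lemma join_nth: "join (u, t) $ 1 = u $ 1" "join (u, t) $ 2 = u $ 2" "join (u, t) $ 3 = t"
  by (simp_all add: join_def axis_def)

lemma prj_join: "prj (join (u, t)) = u"
  by (simp add: vec_eq_iff forall_2 join_nth)

lemma join_measurable [measurable]: "join \<in> borel \<rightarrow>\<^sub>M borel"
  unfolding join_def split_def
  by (intro borel_measurable_continuous_onI continuous_intros)

lemma prj_measurable [measurable]: "prj \<in> borel \<rightarrow>\<^sub>M borel"
  by (intro borel_measurable_continuous_onI linear_continuous_on bounded_linear_prj)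

text \<open>Lebesgue measure is determined by its values on boxes. The lemma makes Fubini available
  for parameter and height in the encoding by \<open>real^3\<close>.\<close>

lemma lborel_join: "lborel = distr (lborel \<Otimes>\<^sub>M lborel) borel join"
proof (rule lborel_eqI)
  fix l u :: "real^3"
  assume "\<And>b. b \<in> Basis \<Longrightarrow> l \<bullet> b \<le> u \<bullet> b"
  then have le: "l $ i \<le> u $ i" for i by (metis axis_in_Basis_iff cart_eq_inner_axis Basis_real_def singletonI)
  have [simp]: "join \<in> lborel \<Otimes>\<^sub>M lborel \<rightarrow>\<^sub>M borel"
    unfolding lborel_prod by simp
  have "join -` box l u \<inter> space (lborel \<Otimes>\<^sub>M lborel) = box (prj l) (prj u) \<times> box (l $ 3) (u $ 3)"
    by (auto simp: space_pair_measure mem_box_cart forall_3 forall_2 join_nth)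
  then have "emeasure (distr (lborel \<Otimes>\<^sub>M lborel) borel join) (box l u)
      = emeasure lborel (box (prj l) (prj u)) * emeasure lborel (box (l $ 3) (u $ 3))"
    by (simp add: emeasure_distr lborel.emeasure_pair_measure_Times)
  also have "emeasure lborel (box (prj l) (prj u)) = ennreal ((u $ 1 - l $ 1) * (u $ 2 - l $ 2))"
  proof -
    have "prj l $ i \<le> prj u $ i" for i using le exhaust_2[of i] by auto
    then have "emeasure lborel (box (prj l) (prj u)) = ennreal (\<Prod>b\<in>Basis. (prj u - prj l) \<bullet> b)"
      by (intro emeasure_lborel_box) (auto simp: Basis_vec_def inner_axis)
    then show ?thesis by (simp add: prod_Basis_cart inner_axis UNIV_2 mult.commute)
  qed
  also have "emeasure lborel (box (l $ 3) (u $ 3)) = ennreal (u $ 3 - l $ 3)" using le by simp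
  also have "ennreal ((u $ 1 - l $ 1) * (u $ 2 - l $ 2)) * ennreal (u $ 3 - l $ 3)
      = ennreal ((u $ 1 - l $ 1) * (u $ 2 - l $ 2) * (u $ 3 - l $ 3))"
    using le[of 3] by (intro ennreal_mult''[symmetric]) simp
  also have "(u $ 1 - l $ 1) * (u $ 2 - l $ 2) * (u $ 3 - l $ 3) = (\<Prod>b\<in>Basis. (u - l) \<bullet> b)"
    unfolding prod_Basis_cart inner_axis prod_3 by (simp only: vector_minus_component inner_real_def mult_1_right)
  finally show "emeasure (distr (lborel \<Otimes>\<^sub>M lborel) borel join) (box l u) = ennreal (\<Prod>b\<in>Basis. (u - l) \<bullet> b)" .
qed simp

lemma nn_integral_lborel_join:
  assumes [measurable]: "f \<in> borel_measurable borel"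
  shows "(\<integral>\<^sup>+x. f x \<partial>lborel) = (\<integral>\<^sup>+u. \<integral>\<^sup>+t. f (join (u, t)) \<partial>lborel \<partial>lborel)"
proof -
  have [measurable]: "join \<in> lborel \<Otimes>\<^sub>M lborel \<rightarrow>\<^sub>M borel"
    unfolding lborel_prod by simp
  have "(\<integral>\<^sup>+x. f x \<partial>lborel) = (\<integral>\<^sup>+x. f (join x) \<partial>(lborel \<Otimes>\<^sub>M lborel))"
    by (subst lborel_join, subst nn_integral_distr) auto
  also have "\<dots> = (\<integral>\<^sup>+u. \<integral>\<^sup>+t. f (join (u, t)) \<partial>lborel \<partial>lborel)"
    by (rule lborel.nn_integral_fst[symmetric]) measurable
  finally show ?thesis .
qed

section \<open>Oriented charts\<close>

lemma local_param_subset: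
  assumes lp: "local_param M U \<phi>" and V: "open V" "V \<subseteq> U"
  shows "local_param M V \<phi>"
proof -
  obtain \<psi> where \<psi>: "homeomorphism U (\<phi> ` U) \<phi> \<psi>" using lp unfolding local_param_def by blast
  have "openin (top_of_set U) V" using V by (simp add: open_subset)
  then have "openin (top_of_set (\<phi> ` U)) (\<phi> ` V)" by (rule homeomorphism_imp_open_map[OF \<psi>])
  then have "openin (top_of_set M) (\<phi> ` V)"
    using lp openin_trans unfolding local_param_def by blast
  moreover have "homeomorphism V (\<phi> ` V) \<phi> \<psi>"
    using homeomorphism_of_subsets[OF \<psi> V(2)] V(2) by blast
  ultimately show ?thesis
    using lp V smooth_on_subset unfolding local_param_def by blast
qed

text \<open>Exchanging the two parameters changes the sign of the area density, which turns a
  negatively oriented chart into a positive one.\<close>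

definition swap2 :: "real^2 \<Rightarrow> real^2" where "swap2 u = vector [u $ 2, u $ 1]"

lemma swap2_swap2 [simp]: "swap2 (swap2 u) = u"
  by (simp add: swap2_def vec_eq_iff forall_2)

lemma bounded_linear_swap2: "bounded_linear swap2"
  unfolding linear_conv_bounded_linear[symmetric] swap2_def
  by (rule linearI) (simp_all add: vec_eq_iff forall_2)

lemma swap2_axis: "swap2 (axis 1 1) = axis 2 1" "swap2 (axis 2 1) = axis 1 1"
  by (simp_all add: swap2_def vec_eq_iff forall_2 axis_def)

lemma local_param_swap2:
  assumes lp: "local_param M U \<phi>"
  shows "local_param M (swap2 -` U) (\<phi> \<circ> swap2)"
proof -
  obtain \<psi> where \<psi>: "homeomorphism U (\<phi> ` U) \<phi> \<psi>" using lp unfolding local_param_def by blast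
  have oU: "open U" using lp unfolding local_param_def by blast
  have im: "(\<phi> \<circ> swap2) ` (swap2 -` U) = \<phi> ` U"
    by (force simp: image_comp[symmetric] intro: image_eqI[of _ _ "swap2 _"])
  have cont: "continuous_on S swap2" for S by (rule linear_continuous_on[OF bounded_linear_swap2])
  have "homeomorphism (swap2 -` U) U swap2 swap2"
    by (intro homeomorphismI cont) auto
  then have "homeomorphism (swap2 -` U) (\<phi> ` U) (\<phi> \<circ> swap2) (swap2 \<circ> \<psi>)"
    by (rule homeomorphism_compose[OF _ \<psi>])
  moreover have "inj (frechet_derivative (\<phi> \<circ> swap2) (at u))" if "swap2 u \<in> U" for u
  proof -
    have "frechet_derivative (\<phi> \<circ> swap2) (at u) = frechet_derivative \<phi> (at (swap2 u)) \<circ> swap2"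
      using frechet_derivative_compose_linear[OF bounded_linear_swap2 differentiableI[OF chart_has_derivative[OF lp that]]]
      by (intro ext) (simp only: comp_apply)
    moreover have "inj (frechet_derivative \<phi> (at (swap2 u)))" using lp that unfolding local_param_def by blast
    moreover have "inj swap2" by (metis injI swap2_swap2)
    ultimately show ?thesis by (simp add: inj_compose)
  qed
  moreover have "open (swap2 -` U)"
    using continuous_open_vimage[OF oU] linear_continuous_at[OF bounded_linear_swap2] by blast
  moreover have "smooth_on (swap2 -` U) (\<phi> \<circ> swap2)"
    using lp unfolding local_param_def by (intro smooth_on_compose_linear[OF bounded_linear_swap2]) auto
  ultimately show ?thesis
    using lp unfolding local_param_def im by blast
qed

context minkowski_surface
begin

text \<open>The density is nonzero and, if necessary after a swap, positive at the given point. By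
  continuity the part of the domain where it is positive is open, and the chart is restricted to
  it.\<close>

lemma obtain_oriented_chart:
  assumes "p \<in> M"
  obtains U \<phi> where "oriented_param M \<eta> U \<phi>" "p \<in> \<phi> ` U"
proof -
  obtain U \<phi> u where lp: "local_param M U \<phi>" and u: "u \<in> U" and p: "p = \<phi> u" using obtain_chart[OF assms] .
  note obtained = that
  have positive: thesis if lp: "local_param M U \<phi>" and u: "u \<in> U" "p = \<phi> u" "area_density \<eta> \<phi> u > 0" for U \<phi> u
  proof -
    let ?V = "U \<inter> area_density \<eta> \<phi> -` {0<..}"
    have "open ?V"
      using lp area_density_continuous[OF lp] unfolding local_param_def
      by (intro continuous_open_preimage) auto
    then have "oriented_param M \<eta> ?V \<phi>"
      unfolding oriented_param_def using local_param_subset[OF lp] by auto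
    then show thesis using obtained[of ?V \<phi>] u by blast
  qed
  show thesis
  proof (cases "area_density \<eta> \<phi> u > 0")
    case True
    then show thesis using positive lp u p by blast
  next
    case False
    have lp': "local_param M (swap2 -` U) (\<phi> \<circ> swap2)" by (rule local_param_swap2[OF lp])
    have u': "swap2 u \<in> swap2 -` U" using u by simp
    have dif: "\<phi> differentiable at (swap2 (swap2 u))"
      using chart_has_derivative[OF lp u] by (auto simp: differentiable_def)
    have "area_density \<eta> (\<phi> \<circ> swap2) (swap2 u) = - area_density \<eta> \<phi> u"
      unfolding area_density_det3[OF lp u] area_density_det3[OF lp' u']
      by (simp add: frechet_derivative_compose_linear[OF bounded_linear_swap2 dif] swap2_axis det_3 algebra_simps)
    then have "area_density \<eta> (\<phi> \<circ> swap2) (swap2 u) > 0"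
      using False area_density_nonzero[OF lp u] by linarith
    then show thesis using positive[OF lp' u'] p by simp
  qed
qed

lemma chart_shift_volume:
  assumes op: "oriented_param M \<eta> U \<phi>" and A: "A \<in> sets borel" "A \<subseteq> U" and t: "t > 0"
    and inj: "inj_on normal_shift (M \<times> {-t..t})"
    and nn: "\<And>p s. p \<in> M \<Longrightarrow> \<bar>s\<bar> \<le> t \<Longrightarrow> tangent_jacobian p 1 s \<ge> 0"
  shows "emeasure lebesgue (normal_shift ` (\<phi> ` A \<times> {-t..t})) =
    (\<integral>\<^sup>+u\<in>A. ennreal (area_density \<eta> \<phi> u * (2 * t + 2 * t ^ 3 / 3 * curvature M \<eta> (\<phi> u))) \<partial>lborel)"
proof -
  have lp: "local_param M U \<phi>" and pos: "\<And>u. u \<in> U \<Longrightarrow> area_density \<eta> \<phi> u > 0"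
    using op unfolding oriented_param_def by auto
  define S where "S = {x. prj x \<in> A \<and> x $ 3 \<in> {-t..t}}"
  have S_join: "join (u, s) \<in> S \<longleftrightarrow> u \<in> A \<and> s \<in> {-t..t}" for u s
    by (simp add: S_def prj_join join_nth)
  have S_borel[measurable]: "S \<in> sets borel"
  proof -
    have "S = (prj -` A) \<inter> ((\<lambda>x. x $ 3) -` {-t..t})" by (auto simp: S_def)
    moreover have "prj -` A \<in> sets borel" using measurable_sets[OF prj_measurable A(1)] by simp
    moreover have "(\<lambda>x::real^3. x $ 3) -` {-t..t} \<in> sets borel"
      by (intro borel_closed closed_vimage continuous_intros)
    ultimately show ?thesis by auto
  qed
  have SU: "prj x \<in> U" if "x \<in> S" for x using that A(2) by (auto simp: S_def)
  have im: "chart_shift \<phi> ` S = normal_shift ` (\<phi> ` A \<times> {-t..t})"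
  proof (intro equalityI subsetI)
    fix z assume "z \<in> normal_shift ` (\<phi> ` A \<times> {-t..t})"
    then obtain u s where "u \<in> A" "s \<in> {-t..t}" "z = normal_shift (\<phi> u, s)" by auto
    then show "z \<in> chart_shift \<phi> ` S"
      by (intro image_eqI[of _ _ "join (u, s)"]) (simp_all add: chart_shift_def S_join prj_join join_nth)
  qed (auto simp: chart_shift_def S_def)
  have inj_chart: "inj_on \<phi> U"
    using lp unfolding local_param_def homeomorphism_def by (metis inj_on_inverseI)
  have injS: "inj_on (chart_shift \<phi>) S"
  proof (rule inj_onI)
    fix x y assume xy: "x \<in> S" "y \<in> S" and eq: "chart_shift \<phi> x = chart_shift \<phi> y"
    have "\<phi> (prj x) \<in> M" "\<phi> (prj y) \<in> M" using chart_in_M[OF lp] SU xy by auto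
    then have "(\<phi> (prj x), x $ 3) = (\<phi> (prj y), y $ 3)"
      using eq xy inj unfolding chart_shift_def S_def by (intro inj_onD[OF inj]) auto
    then have "prj x = prj y" "x $ 3 = y $ 3" using inj_chart SU xy by (auto dest: inj_onD)
    moreover have "x $ 1 = y $ 1" "x $ 2 = y $ 2" using \<open>prj x = prj y\<close> by (metis prj_nth)+
    ultimately show "x = y" by (simp add: vec_eq_iff forall_3)
  qed
  have der: "(chart_shift \<phi> has_derivative chart_shift_deriv \<phi> x) (at x within S)" if "x \<in> S" for x
    using chart_shift_has_derivative[OF lp SU[OF that]] by (rule has_derivative_at_withinI)
  \<comment> \<open>A is an arbitrary Borel set, possibly unbounded; finiteness comes from the
    compact image of the whole of M.\<close>
  have lm: "chart_shift \<phi> ` S \<in> lmeasurable"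
  proof (rule fmeasurableI2)
    show "normal_shift ` (M \<times> {-t..t}) \<in> lmeasurable"
      by (intro lmeasurable_compact compact_continuous_image normal_shift_continuous compact_Times M_compact compact_Icc)
    show "chart_shift \<phi> ` S \<subseteq> normal_shift ` (M \<times> {-t..t})"
      unfolding im using A(2) chart_subset[OF lp] by (intro image_mono) auto
    show "chart_shift \<phi> ` S \<in> sets lebesgue"
      using der S_borel by (intro differentiable_image_in_sets_lebesgue) (auto simp: differentiable_on_def differentiable_def)
  qed
  let ?g = "\<lambda>x. \<bar>det (matrix (chart_shift_deriv \<phi> x))\<bar>"
  have g: "?g x = tangent_jacobian (\<phi> (prj x)) 1 (x $ 3) * area_density \<eta> \<phi> (prj x)" if "x \<in> S" for x
  proof -
    have "tangent_jacobian (\<phi> (prj x)) 1 (x $ 3) \<ge> 0"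
      using that chart_in_M[OF lp SU[OF that]] by (intro nn) (auto simp: S_def)
    then show ?thesis
      using pos[OF SU[OF that]] unfolding det_chart_shift_deriv[OF lp SU[OF that]] by (simp add: abs_mult)
  qed
  have "(?g has_integral measure lebesgue (chart_shift \<phi> ` S)) S"
    using has_measure_differentiable_image[OF _ der injS] lm S_borel by auto
  then have "(\<integral>\<^sup>+x. ennreal (indicator S x * ?g x) \<partial>lborel) = ennreal (measure lebesgue (chart_shift \<phi> ` S))"
    by (intro nn_integral_has_integral_lebesgue) auto
  then have "emeasure lebesgue (chart_shift \<phi> ` S) = (\<integral>\<^sup>+x. ennreal (indicator S x * ?g x) \<partial>lborel)"
    using lm by (simp add: emeasure_eq_measure2)
  also have "\<dots> = (\<integral>\<^sup>+u. \<integral>\<^sup>+s. ennreal (indicator S (join (u, s)) * ?g (join (u, s))) \<partial>lborel \<partial>lborel)"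
  proof (rule nn_integral_lborel_join)
    \<comment> \<open>The Jacobian is known to be continuous only over U; the indicator of S makes
      it a Borel function on the whole space.\<close>
    have "continuous_on {x. prj x \<in> U} ?g"
      unfolding det_matrix_columns by (intro continuous_intros chart_shift_deriv_continuous[OF lp])
    then have "continuous_on S ?g" by (rule continuous_on_subset) (use SU in auto)
    then have "(\<lambda>x. indicator S x *\<^sub>R ?g x) \<in> borel_measurable borel"
      by (rule borel_measurable_continuous_on_indicator[OF S_borel])
    then show "(\<lambda>x. ennreal (indicator S x * ?g x)) \<in> borel_measurable borel"
      unfolding real_scaleR_def by (rule measurable_compose) simp
  qed
  also have "\<dots> = (\<integral>\<^sup>+u\<in>A. ennreal (area_density \<eta> \<phi> u * (2 * t + 2 * t ^ 3 / 3 * curvature M \<eta> (\<phi> u))) \<partial>lborel)"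
  proof (rule nn_integral_cong)
    fix u :: "real^2"
    show "(\<integral>\<^sup>+s. ennreal (indicator S (join (u, s)) * ?g (join (u, s))) \<partial>lborel) =
      ennreal (area_density \<eta> \<phi> u * (2 * t + 2 * t ^ 3 / 3 * curvature M \<eta> (\<phi> u))) * indicator A u"
    proof (cases "u \<in> A")
      case False
      then have "indicator S (join (u, s)) = (0::real)" for s by (simp add: S_join)
      then show ?thesis using False by simp
    next
      case True
      then have uM: "\<phi> u \<in> M" and uU: "u \<in> U" using chart_in_M[OF lp] A(2) by auto
      let ?d = "area_density \<eta> \<phi> u" and ?H = "mean_curvature (\<phi> u)" and ?K = "curvature M \<eta> (\<phi> u)"
      \<comment> \<open>An antiderivative in s of the Jacobian. Its term in H is even and drops out
        of \<open>?F t - ?F (-t)\<close>.\<close>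
      let ?F = "\<lambda>s. ?d * (s + s\<^sup>2 / 2 * ?H + s ^ 3 / 3 * ?K)"
      have "(\<integral>\<^sup>+s. ennreal (indicator S (join (u, s)) * ?g (join (u, s))) \<partial>lborel) =
        (\<integral>\<^sup>+s. ennreal (?d * (1 + s * ?H + s\<^sup>2 * ?K)) * indicator {-t..t} s \<partial>lborel)"
      proof (rule nn_integral_cong)
        fix s
        show "ennreal (indicator S (join (u, s)) * ?g (join (u, s))) = ennreal (?d * (1 + s * ?H + s\<^sup>2 * ?K)) * indicator {-t..t} s"
        proof (cases "s \<in> {-t..t}")
          case s: True
          then have "join (u, s) \<in> S" using True S_join by blast
          then show ?thesis using g s by (simp add: prj_join join_nth tangent_jacobian_polynomial[OF uM] mult.commute)
        next
          case False
          then have "join (u, s) \<notin> S" using S_join by blast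
          then show ?thesis using False by simp
        qed
      qed
      also have "\<dots> = ?F t - ?F (-t)"
      proof (rule nn_integral_FTC_Icc)
        fix s assume s: "s \<in> {-t..t}"
        show "(?F has_real_derivative ?d * (1 + s * ?H + s\<^sup>2 * ?K)) (at s)"
          by (auto intro!: derivative_eq_intros simp: field_simps power2_eq_square)
        have "1 + s * ?H + s\<^sup>2 * ?K \<ge> 0"
          using nn[OF uM, of s] s unfolding tangent_jacobian_polynomial[OF uM] by auto
        then show "0 \<le> ?d * (1 + s * ?H + s\<^sup>2 * ?K)" using pos[OF uU] by simp
      qed (use t in auto)
      also have "?F t - ?F (-t) = ?d * (2 * t + 2 * t ^ 3 / 3 * ?K)"
        by (simp add: field_simps power3_eq_cube)
      finally show ?thesis using True by simp
    qed
  qed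
  finally show ?thesis unfolding im .
qed

end

section \<open>The area measure\<close>

context minkowski_surface
begin

lemma M_borel: "M \<in> sets borel"
  using M_compact by (intro borel_closed compact_imp_closed)

lemma sets_M_iff: "B \<in> sets (restrict_space borel M) \<longleftrightarrow> B \<subseteq> M \<and> B \<in> sets borel"
  using M_borel by (auto simp: sets_restrict_space_iff)

lemma chart_image_borel:
  assumes lp: "local_param M U \<phi>" and A: "A \<in> sets borel" "A \<subseteq> U"
  shows "\<phi> ` A \<in> sets (restrict_space borel M)"
proof -
  obtain \<psi> where \<psi>: "homeomorphism U (\<phi> ` U) \<phi> \<psi>" using lp unfolding local_param_def by blast
  obtain W where W: "open W" "\<phi> ` U = M \<inter> W"
    using lp unfolding local_param_def openin_open by metis
  have UB: "\<phi> ` U \<in> sets borel" unfolding W(2) using W(1) M_borel by auto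
  have "continuous_on (\<phi> ` U) \<psi>" using \<psi> unfolding homeomorphism_def by blast
  then have "\<psi> \<in> borel_measurable (restrict_space borel (\<phi> ` U))"
    by (rule borel_measurable_continuous_on_restrict)
  from measurable_sets[OF this A(1)] have "\<psi> -` A \<inter> \<phi> ` U \<in> sets (restrict_space borel (\<phi> ` U))"
    by (simp add: space_restrict_space)
  then have "\<psi> -` A \<inter> \<phi> ` U \<in> sets borel" using UB by (simp add: sets_restrict_space_iff)
  moreover have "\<psi> -` A \<inter> \<phi> ` U = \<phi> ` A" using \<psi> A(2) by (auto simp: homeomorphism_def)
  moreover have "\<phi> ` A \<subseteq> M" using chart_subset[OF lp] A(2) by blast
  ultimately show ?thesis unfolding sets_M_iff by simp
qed

lemma chart_measurable:
  assumes lp: "local_param M U \<phi>"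
  shows "\<phi> \<in> restrict_space borel U \<rightarrow>\<^sub>M restrict_space borel M"
  using chart_subset[OF lp] lp smooth_on_continuous unfolding local_param_def
  by (intro measurable_restrict_space2 borel_measurable_continuous_on_restrict)
    (auto simp: space_restrict_space)

lemma chart_open: "local_param M U \<phi> \<Longrightarrow> U \<in> sets borel"
  unfolding local_param_def by auto

lemma chart_vimage_borel:
  assumes lp: "local_param M U \<phi>" and B: "B \<in> sets (restrict_space borel M)"
  shows "\<phi> -` B \<inter> U \<in> sets borel"
  using measurable_sets[OF chart_measurable[OF lp] B] chart_open[OF lp]
  by (simp add: space_restrict_space sets_restrict_space_iff)

text \<open>The uniqueness half of \<open>area_measure\<close>. Compactness gives finitely many
  oriented chart images covering M, and they are split off one after another. Only additivity is
  used, never subtraction, so no finiteness of the measures has to be assumed.\<close>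

lemma measure_eqI_oriented_charts:
  assumes sets: "sets \<mu> = sets (restrict_space borel M)" "sets \<nu> = sets (restrict_space borel M)"
    and eq: "\<And>U \<phi> A. oriented_param M \<eta> U \<phi> \<Longrightarrow> A \<in> sets borel \<Longrightarrow> A \<subseteq> U \<Longrightarrow>
      emeasure \<mu> (\<phi> ` A) = emeasure \<nu> (\<phi> ` A)"
  shows "\<mu> = \<nu>"
proof -
  define \<O> where "\<O> = {\<phi> ` U | U \<phi>. oriented_param M \<eta> U \<phi>}"
  have \<O>_sets: "W \<in> sets \<mu>" if "W \<in> \<O>" for W
    using that chart_image_borel chart_open unfolding \<O>_def oriented_param_def sets by auto
  have \<O>_eq: "emeasure \<mu> B = emeasure \<nu> B" if WB: "W \<in> \<O>" "B \<subseteq> W" "B \<in> sets \<mu>" for W B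
  proof -
    obtain U \<phi> where W: "W = \<phi> ` U" "oriented_param M \<eta> U \<phi>" using WB(1) unfolding \<O>_def by blast
    have "\<phi> -` B \<inter> U \<in> sets borel"
      using W(2) WB(3) chart_vimage_borel unfolding oriented_param_def sets by blast
    then have "emeasure \<mu> (\<phi> ` (\<phi> -` B \<inter> U)) = emeasure \<nu> (\<phi> ` (\<phi> -` B \<inter> U))" by (intro eq[OF W(2)]) auto
    moreover have "\<phi> ` (\<phi> -` B \<inter> U) = B" using WB(2) unfolding W(1) by auto
    ultimately show ?thesis by simp
  qed
  have "\<exists>T. open T \<and> M \<inter> T = W" if "W \<in> \<O>" for W
    using that unfolding \<O>_def oriented_param_def local_param_def openin_open by blast
  then obtain T where T: "\<And>W. W \<in> \<O> \<Longrightarrow> open (T W) \<and> M \<inter> T W = W" by metis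
  have "M \<subseteq> (\<Union>W\<in>\<O>. T W)"
  proof
    fix p assume "p \<in> M"
    then obtain U \<phi> where "oriented_param M \<eta> U \<phi>" "p \<in> \<phi> ` U" by (rule obtain_oriented_chart)
    then have "\<phi> ` U \<in> \<O>" unfolding \<O>_def by blast
    then show "p \<in> (\<Union>W\<in>\<O>. T W)" using T \<open>p \<in> \<phi> ` U\<close> by blast
  qed
  then obtain \<C> where \<C>: "\<C> \<subseteq> \<O>" "finite \<C>" "M \<subseteq> (\<Union>W\<in>\<C>. T W)"
    using compactE_image[OF M_compact, of \<O> T] T by blast
  have "M \<subseteq> \<Union>\<C>" using \<C>(1,3) T by blast
  have "\<forall>B\<in>sets \<mu>. B \<subseteq> \<Union>\<C> \<longrightarrow> emeasure \<mu> B = emeasure \<nu> B"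
    using \<C>(2,1)
  proof (induction \<C> rule: finite_induct)
    case empty
    then show ?case by simp
  next
    case (insert W \<C>)
    show ?case
    proof (intro ballI impI)
      fix B assume B: "B \<in> sets \<mu>" "B \<subseteq> \<Union>(insert W \<C>)"
      have W: "W \<in> sets \<mu>" using insert \<O>_sets by blast
      have 1: "emeasure \<mu> (B \<inter> W) = emeasure \<nu> (B \<inter> W)" using insert.prems B(1) W by (intro \<O>_eq[of W]) auto
      have 2: "emeasure \<mu> (B - W) = emeasure \<nu> (B - W)"
      proof -
        have "B - W \<in> sets \<mu>" "B - W \<subseteq> \<Union>\<C>" using B W by auto
        then show ?thesis using insert by blast
      qed
      have "emeasure m B = emeasure m (B \<inter> W) + emeasure m (B - W)" if "sets m = sets \<mu>" for m
        using B(1) W that plus_emeasure[of "B \<inter> W" m "B - W"] by (simp add: Int_Diff_Un Int_Diff_disjoint)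
      then show "emeasure \<mu> B = emeasure \<nu> B" using 1 2 sets by metis
    qed
  qed
  then show ?thesis
    using \<open>M \<subseteq> \<Union>\<C>\<close> sets by (intro measure_eqI) (auto simp: sets_M_iff)
qed

lemma nn_integral_chart:
  assumes \<nu>: "sets \<nu> = sets (restrict_space borel M)" and lp: "local_param M U \<phi>"
    and g[measurable]: "g \<in> borel_measurable borel"
    and eq: "\<And>A. A \<in> sets borel \<Longrightarrow> A \<subseteq> U \<Longrightarrow> emeasure \<nu> (\<phi> ` A) = (\<integral>\<^sup>+u\<in>A. g u \<partial>lborel)"
    and h: "h \<in> borel_measurable (restrict_space borel M)"
    and A: "A \<in> sets borel" "A \<subseteq> U"
  shows "(\<integral>\<^sup>+p\<in>\<phi> ` A. h p \<partial>\<nu>) = (\<integral>\<^sup>+u\<in>A. h (\<phi> u) * g u \<partial>lborel)"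
proof -
  have UB[measurable]: "U \<in> sets borel" by (rule chart_open[OF lp])
  have inj_chart: "inj_on \<phi> U"
    using lp unfolding local_param_def homeomorphism_def by (metis inj_on_inverseI)
  \<comment> \<open>Measurability of \<phi> is available on U only, so the source measure is
    restricted before pushing forward.\<close>
  define \<rho> where "\<rho> = restrict_space (density lborel g) U"
  have sets_\<rho>: "sets \<rho> = sets (restrict_space borel U)"
    unfolding \<rho>_def by (rule sets_restrict_space_cong) simp
  have \<phi>: "\<phi> \<in> \<rho> \<rightarrow>\<^sub>M \<nu>"
    using chart_measurable[OF lp] measurable_cong_sets[OF sets_\<rho> \<nu>] by blast
  have h\<nu>: "h \<in> borel_measurable \<nu>" using h measurable_cong_sets[OF \<nu> refl] by blast
  have \<phi>U: "\<phi> ` U \<in> sets \<nu>" unfolding \<nu> by (rule chart_image_borel[OF lp UB order_refl])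
  have \<phi>A: "\<phi> ` A \<in> sets \<nu>" unfolding \<nu> by (rule chart_image_borel[OF lp A])
  have "density \<nu> (indicator (\<phi> ` U)) = distr \<rho> \<nu> \<phi>"
  proof (rule measure_eqI)
    fix B assume "B \<in> sets (density \<nu> (indicator (\<phi> ` U)))"
    then have B: "B \<in> sets \<nu>" by simp
    have vB: "\<phi> -` B \<inter> U \<in> sets borel" using chart_vimage_borel[OF lp] B unfolding \<nu> by blast
    have "emeasure (distr \<rho> \<nu> \<phi>) B = emeasure \<rho> (\<phi> -` B \<inter> U)"
      using emeasure_distr[OF \<phi> B] by (simp add: \<rho>_def space_restrict_space)
    also have "\<dots> = emeasure (density lborel g) (\<phi> -` B \<inter> U)"
      unfolding \<rho>_def by (rule emeasure_restrict_space) auto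
    also have "\<dots> = (\<integral>\<^sup>+u\<in>\<phi> -` B \<inter> U. g u \<partial>lborel)" using vB by (simp add: emeasure_density)
    also have "\<dots> = emeasure \<nu> (\<phi> ` (\<phi> -` B \<inter> U))" using vB by (intro eq[symmetric]) auto
    also have "\<phi> ` (\<phi> -` B \<inter> U) = \<phi> ` U \<inter> B" by auto
    also have "emeasure \<nu> (\<phi> ` U \<inter> B) = emeasure (density \<nu> (indicator (\<phi> ` U))) B"
      using B \<phi>U by (simp add: emeasure_density flip: indicator_inter_arith)
    finally show "emeasure (density \<nu> (indicator (\<phi> ` U))) B = emeasure (distr \<rho> \<nu> \<phi>) B" ..
  qed simp
  moreover have "(\<integral>\<^sup>+p\<in>\<phi> ` A. h p \<partial>(density \<nu> (indicator (\<phi> ` U)))) = (\<integral>\<^sup>+p\<in>\<phi> ` A. h p \<partial>\<nu>)"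
  proof -
    have "indicator (\<phi> ` U) p * (h p * indicator (\<phi> ` A) p) = h p * indicator (\<phi> ` A) p" for p
      using A(2) by (cases "p \<in> \<phi> ` A") (auto simp: indicator_def)
    then show ?thesis using h\<nu> \<phi>U \<phi>A by (subst nn_integral_density) auto
  qed
  moreover have "(\<integral>\<^sup>+p\<in>\<phi> ` A. h p \<partial>(distr \<rho> \<nu> \<phi>)) = (\<integral>\<^sup>+u. h (\<phi> u) * indicator (\<phi> ` A) (\<phi> u) \<partial>\<rho>)"
    using \<phi> h\<nu> \<phi>A by (intro nn_integral_distr) auto
  moreover have "\<dots> = (\<integral>\<^sup>+u. h (\<phi> u) * indicator (\<phi> ` A) (\<phi> u) * indicator U u \<partial>(density lborel g))"
    unfolding \<rho>_def by (subst nn_integral_restrict_space) auto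
  moreover have "\<dots> = (\<integral>\<^sup>+u. g u * (h (\<phi> u) * indicator (\<phi> ` A) (\<phi> u) * indicator U u) \<partial>lborel)"
  proof (rule nn_integral_density)
    have "(\<lambda>u. h (\<phi> u) * indicator (\<phi> ` A) (\<phi> u)) \<in> borel_measurable \<rho>"
      using measurable_compose[OF \<phi>, of "\<lambda>p. h p * indicator (\<phi> ` A) p" borel] h\<nu> \<phi>A by simp
    then have "(\<lambda>u. h (\<phi> u) * indicator (\<phi> ` A) (\<phi> u)) \<in> borel_measurable (restrict_space borel U)"
      using measurable_cong_sets[OF sets_\<rho> refl] by blast
    then show "(\<lambda>u. h (\<phi> u) * indicator (\<phi> ` A) (\<phi> u) * indicator U u) \<in> borel_measurable lborel"
      using borel_measurable_restrict_space_iff_ennreal[of U borel] by simp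
  qed simp
  moreover have "\<dots> = (\<integral>\<^sup>+u\<in>A. h (\<phi> u) * g u \<partial>lborel)"
  proof (rule nn_integral_cong)
    fix u
    have "indicator (\<phi> ` A) (\<phi> u) * indicator U u = (indicator A u :: ennreal)"
      using A(2) inj_chart by (auto split: split_indicator dest: inj_onD)
    then show "g u * (h (\<phi> u) * indicator (\<phi> ` A) (\<phi> u) * indicator U u) = h (\<phi> u) * g u * indicator A u"
      by (metis mult.assoc mult.commute)
  qed
  ultimately show ?thesis by simp
qed

text \<open>The set function is the pushforward of Lebesgue measure on the tube under the map
  sending a point to its foot on M, hence countably additive. That map is continuous because a
  continuous injection of a compact set has a continuous inverse.\<close>

lemma obtain_tube_measure:
  assumes inj: "inj_on normal_shift (M \<times> {-t..t})"
  obtains \<nu> where "sets \<nu> = sets (restrict_space borel M)"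
    "\<And>B. B \<in> sets (restrict_space borel M) \<Longrightarrow> emeasure \<nu> B = emeasure lebesgue (normal_shift ` (B \<times> {-t..t}))"
proof -
  let ?T = "normal_shift ` (M \<times> {-t..t})"
  have cI: "compact (M \<times> {-t..t})" using M_compact by (intro compact_Times compact_Icc)
  obtain g where g: "homeomorphism (M \<times> {-t..t}) ?T normal_shift g"
    using homeomorphism_compact[OF cI normal_shift_continuous refl inj] by blast
  have T: "?T \<in> sets lebesgue"
    using lmeasurable_compact[OF compact_continuous_image[OF normal_shift_continuous cI]] by blast
  have gT: "g z \<in> M \<times> {-t..t}" if "z \<in> ?T" for z using g that unfolding homeomorphism_def by blast
  have "continuous_on ?T (\<lambda>z. fst (g z))"
    using g unfolding homeomorphism_def by (intro continuous_on_fst) blast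
  then have m: "(\<lambda>z. fst (g z)) \<in> lebesgue_on ?T \<rightarrow>\<^sub>M restrict_space borel M"
    using T gT by (intro measurable_restrict_space2 continuous_imp_measurable_on_sets_lebesgue)
      (fastforce simp: space_restrict_space)+
  show thesis
  proof
    fix B assume B: "B \<in> sets (restrict_space borel M)"
    then have "B \<subseteq> M" by (simp add: sets_M_iff)
    have "(\<lambda>z. fst (g z)) -` B \<inter> ?T = normal_shift ` (B \<times> {-t..t})"
    proof (intro equalityI subsetI)
      fix z assume z: "z \<in> (\<lambda>z. fst (g z)) -` B \<inter> ?T"
      then have "normal_shift (g z) = z" "g z \<in> B \<times> {-t..t}"
        using g gT[of z] by (auto simp: homeomorphism_def mem_Times_iff)
      then show "z \<in> normal_shift ` (B \<times> {-t..t})" by (metis imageI)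
    next
      fix z assume "z \<in> normal_shift ` (B \<times> {-t..t})"
      then obtain x where x: "x \<in> B \<times> {-t..t}" "z = normal_shift x" by blast
      then have xM: "x \<in> M \<times> {-t..t}" using \<open>B \<subseteq> M\<close> by auto
      then have "g z = x" using homeomorphism_apply1[OF g xM] x(2) by simp
      then show "z \<in> (\<lambda>z. fst (g z)) -` B \<inter> ?T" using x xM by (auto simp: mem_Times_iff)
    qed
    then show "emeasure (distr (lebesgue_on ?T) (restrict_space borel M) (\<lambda>z. fst (g z))) B
        = emeasure lebesgue (normal_shift ` (B \<times> {-t..t}))"
      using emeasure_distr[OF m B] T
      by (simp add: space_restrict_space emeasure_restrict_space flip: \<open>_ = normal_shift ` (B \<times> {-t..t})\<close>)
  qed simp
qed

lemma tube_volume: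
  "\<exists>\<epsilon>\<^sub>0>0. \<forall>\<epsilon>. 0 < \<epsilon> \<and> \<epsilon> < \<epsilon>\<^sub>0 \<longrightarrow>
    tube N M \<epsilon> \<in> lmeasurable \<and>
    measure lebesgue (tube N M \<epsilon>) =
      2 * \<epsilon> * measure (area_measure M \<eta>) M
      + 2 * \<epsilon> ^ 3 / 3 * (\<integral>p. curvature M \<eta> p \<partial>area_measure M \<eta>)"
proof -
  obtain \<delta>1 where \<delta>1: "\<delta>1 > 0" "\<And>p t. p \<in> M \<Longrightarrow> \<bar>t\<bar> \<le> \<delta>1 \<Longrightarrow> tangent_jacobian p 1 t \<ge> 0"
    "\<And>p t. p \<in> M \<Longrightarrow> \<bar>t\<bar> \<le> \<delta>1 \<Longrightarrow> \<bar>t\<^sup>2 * curvature M \<eta> p\<bar> \<le> 1"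
    using small_radius by blast
  obtain \<delta>2 where \<delta>2: "\<delta>2 > 0" "inj_on normal_shift (M \<times> {-\<delta>2..\<delta>2})" using normal_shift_injective by blast
  define \<delta> where "\<delta> = min \<delta>1 \<delta>2"
  have \<delta>: "\<delta> > 0" "\<delta> \<le> \<delta>1" "\<delta> \<le> \<delta>2" using \<delta>1(1) \<delta>2(1) by (auto simp: \<delta>_def)
  have inj: "inj_on normal_shift (M \<times> {-t..t})" if "t \<le> \<delta>" for t
    by (rule inj_on_subset[OF \<delta>2(2)]) (use \<delta>(3) that in auto)
  define q where "q t p = 2 * t + 2 * t ^ 3 / 3 * curvature M \<eta> p" for t p
  \<comment> \<open>From t^2 K >= -1 the weight is at least 2t - 2t/3. This positive lower bound
    permits the division by q.\<close>
  have q_ge: "q t p \<ge> 4 * t / 3" if "0 < t" "t \<le> \<delta>" "p \<in> M" for t p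
  proof -
    have "t\<^sup>2 * curvature M \<eta> p \<ge> -1" using \<delta>1(3)[of p t] that \<delta>(2) by (auto simp: abs_le_iff)
    then have "(2 * t / 3) * (t\<^sup>2 * curvature M \<eta> p) \<ge> (2 * t / 3) * (-1)"
      using that(1) by (intro mult_left_mono) auto
    then show ?thesis by (simp add: q_def power2_eq_square power3_eq_cube)
  qed
  have K_meas: "curvature M \<eta> \<in> borel_measurable (restrict_space borel M)"
    by (rule borel_measurable_continuous_on_restrict[OF curvature_continuous])
  have q_meas: "q t \<in> borel_measurable (restrict_space borel M)" for t
    unfolding q_def using K_meas by simp
  have "\<exists>\<nu>. sets \<nu> = sets (restrict_space borel M) \<and>
    (\<forall>B\<in>sets (restrict_space borel M). emeasure \<nu> B = emeasure lebesgue (normal_shift ` (B \<times> {-t..t})))"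
    if "t \<le> \<delta>" for t
    using obtain_tube_measure[OF inj[OF that]] by metis
  then obtain \<nu> where \<nu>_sets: "\<And>t. t \<le> \<delta> \<Longrightarrow> sets (\<nu> t) = sets (restrict_space borel M)"
    and \<nu>: "\<And>t B. t \<le> \<delta> \<Longrightarrow> B \<in> sets (restrict_space borel M) \<Longrightarrow>
      emeasure (\<nu> t) B = emeasure lebesgue (normal_shift ` (B \<times> {-t..t}))"
    by metis
  have \<nu>_chart: "emeasure (\<nu> t) (\<phi> ` A) = (\<integral>\<^sup>+u\<in>A. ennreal (area_density \<eta> \<phi> u * q t (\<phi> u)) \<partial>lborel)"
    if "0 < t" "t \<le> \<delta>" "oriented_param M \<eta> U \<phi>" "A \<in> sets borel" "A \<subseteq> U" for t U \<phi> A
    using chart_shift_volume[OF that(3-5,1) inj[OF that(2)] \<delta>1(2)] that \<delta>(2)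
      \<nu>[OF that(2) chart_image_borel[OF _ that(4,5)]]
    unfolding q_def oriented_param_def by auto
  \<comment> \<open>In every oriented chart the tube measure of height \<delta> has the area density
    times \<open>q \<delta>\<close> as density, so dividing by \<open>q \<delta>\<close> leaves the
    area density.\<close>
  define \<mu> where "\<mu> = density (\<nu> \<delta>) (\<lambda>p. ennreal (1 / q \<delta> p))"
  have \<mu>_sets: "sets \<mu> = sets (restrict_space borel M)" unfolding \<mu>_def using \<nu>_sets by simp
  \<comment> \<open>The area density carries information only on U and is cut off there to become a
    Borel function; \<open>cut\<close> below removes the cutoff again for A inside U.\<close>
  have density_meas: "(\<lambda>u. ennreal (f u) * indicator U u) \<in> borel_measurable borel"
    if "local_param M U \<phi>" "continuous_on U f" for U \<phi> f
  proof -
    have "(\<lambda>u. indicator U u *\<^sub>R f u) \<in> borel_measurable borel"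
      by (rule borel_measurable_continuous_on_indicator[OF chart_open[OF that(1)] that(2)])
    then have "(\<lambda>u. ennreal (indicator U u * f u)) \<in> borel_measurable borel" by simp
    then show ?thesis by (rule measurable_cong[THEN iffD1, rotated]) (simp split: split_indicator)
  qed
  have transfer: "(\<integral>\<^sup>+p\<in>\<phi> ` A. h p \<partial>m) = (\<integral>\<^sup>+u\<in>A. h (\<phi> u) * ennreal (f u) \<partial>lborel)"
    if m: "sets m = sets (restrict_space borel M)" and op: "oriented_param M \<eta> U \<phi>" and A: "A \<in> sets borel" "A \<subseteq> U"
      and f: "continuous_on U f"
      and eq: "\<And>A. A \<in> sets borel \<Longrightarrow> A \<subseteq> U \<Longrightarrow> emeasure m (\<phi> ` A) = (\<integral>\<^sup>+u\<in>A. ennreal (f u) \<partial>lborel)"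
      and h: "h \<in> borel_measurable (restrict_space borel M)" for m U \<phi> A f h
  proof -
    have lp: "local_param M U \<phi>" using op unfolding oriented_param_def by blast
    have cut: "(\<integral>\<^sup>+u\<in>A. k u * (ennreal (f u) * indicator U u) \<partial>lborel) = (\<integral>\<^sup>+u\<in>A. k u * ennreal (f u) \<partial>lborel)"
      if "A \<subseteq> U" for A k
      using that by (intro nn_integral_cong) (auto split: split_indicator)
    show ?thesis
      using nn_integral_chart[OF m lp density_meas[OF lp f] _ h A] eq cut[of _ "\<lambda>_. 1"] cut[OF A(2), of "\<lambda>u. h (\<phi> u)"] by simp
  qed
  have cont: "continuous_on U (area_density \<eta> \<phi>)" "continuous_on U (\<lambda>u. area_density \<eta> \<phi> u * q t (\<phi> u))"
    if "local_param M U \<phi>" for U \<phi> t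
  proof -
    show *: "continuous_on U (area_density \<eta> \<phi>)" by (rule area_density_continuous[OF that])
    have "continuous_on U \<phi>" using that smooth_on_continuous unfolding local_param_def by blast
    then have "continuous_on U (\<lambda>u. curvature M \<eta> (\<phi> u))"
      by (rule continuous_on_compose2[OF curvature_continuous _ chart_subset[OF that]])
    then show "continuous_on U (\<lambda>u. area_density \<eta> \<phi> u * q t (\<phi> u))"
      unfolding q_def by (intro continuous_intros *)
  qed
  have \<mu>_chart: "emeasure \<mu> (\<phi> ` A) = (\<integral>\<^sup>+u\<in>A. ennreal (area_density \<eta> \<phi> u) \<partial>lborel)"
    if op: "oriented_param M \<eta> U \<phi>" and A: "A \<in> sets borel" "A \<subseteq> U" for U \<phi> A
  proof -
    have lp: "local_param M U \<phi>" and pos: "\<And>u. u \<in> U \<Longrightarrow> area_density \<eta> \<phi> u > 0"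
      using op unfolding oriented_param_def by auto
    have h: "(\<lambda>p. ennreal (1 / q \<delta> p)) \<in> borel_measurable (restrict_space borel M)" using q_meas[of \<delta>] by simp
    have "emeasure \<mu> (\<phi> ` A) = (\<integral>\<^sup>+p\<in>\<phi> ` A. ennreal (1 / q \<delta> p) \<partial>\<nu> \<delta>)"
      unfolding \<mu>_def using h chart_image_borel[OF lp A] measurable_cong_sets[OF \<nu>_sets[OF order_refl] refl] \<nu>_sets[OF order_refl]
      by (intro emeasure_density) auto
    also have "\<dots> = (\<integral>\<^sup>+u\<in>A. ennreal (1 / q \<delta> (\<phi> u)) * ennreal (area_density \<eta> \<phi> u * q \<delta> (\<phi> u)) \<partial>lborel)"
      using \<delta>(1) by (intro transfer[OF \<nu>_sets op A cont(2)[OF lp] _ h] \<nu>_chart[OF _ _ op]) auto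
    also have "\<dots> = (\<integral>\<^sup>+u\<in>A. ennreal (area_density \<eta> \<phi> u) \<partial>lborel)"
    proof (rule nn_integral_cong)
      fix u
      have "ennreal (1 / q \<delta> (\<phi> u)) * ennreal (area_density \<eta> \<phi> u * q \<delta> (\<phi> u)) = ennreal (area_density \<eta> \<phi> u)" if "u \<in> A"
      proof -
        have "q \<delta> (\<phi> u) > 0" using q_ge[OF \<delta>(1) order_refl, of "\<phi> u"] \<delta>(1) chart_in_M[OF lp] A that by fastforce
        then show ?thesis using pos[of u] A that by (subst ennreal_mult'[symmetric]) auto
      qed
      then show "ennreal (1 / q \<delta> (\<phi> u)) * ennreal (area_density \<eta> \<phi> u * q \<delta> (\<phi> u)) * indicator A u
          = ennreal (area_density \<eta> \<phi> u) * indicator A u" by (auto split: split_indicator)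
    qed
    finally show ?thesis .
  qed
  \<comment> \<open>Here the definite description is resolved: \<open>\<mu>_chart\<close> gives
    existence and the oriented charts give uniqueness.\<close>
  have area: "area_measure M \<eta> = \<mu>"
    unfolding area_measure_def
  proof (rule the_equality)
    fix m
    assume "sets m = sets (restrict_space borel M) \<and>
        (\<forall>U \<phi> A. oriented_param M \<eta> U \<phi> \<longrightarrow> A \<in> sets borel \<longrightarrow> A \<subseteq> U \<longrightarrow>
           emeasure m (\<phi> ` A) = (\<integral>\<^sup>+u\<in>A. ennreal (area_density \<eta> \<phi> u) \<partial>lborel))"
    then show "m = \<mu>"
      using \<mu>_sets \<mu>_chart by (intro measure_eqI_oriented_charts) auto
  qed (use \<mu>_sets \<mu>_chart in blast)
  have space_\<mu>: "space \<mu> = M" using sets_eq_imp_space_eq[OF \<mu>_sets] by (simp add: space_restrict_space)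
  have M_sets: "M \<in> sets (restrict_space borel M)" using M_borel by (simp add: sets_M_iff)
  have meas_\<mu>: "f \<in> borel_measurable \<mu>" if "f \<in> borel_measurable (restrict_space borel M)" for f :: "real^3 \<Rightarrow> real"
    using that measurable_cong_sets[OF \<mu>_sets refl] by blast
  have tube: "tube N M \<epsilon> \<in> lmeasurable" "emeasure lebesgue (tube N M \<epsilon>) = (\<integral>\<^sup>+p. ennreal (q \<epsilon> p) \<partial>\<mu>)"
    if \<epsilon>: "0 < \<epsilon>" "\<epsilon> \<le> \<delta>" for \<epsilon>
  proof -
    show "tube N M \<epsilon> \<in> lmeasurable"
      unfolding tube_eq[OF \<epsilon>(1)]
      by (intro lmeasurable_compact compact_continuous_image normal_shift_continuous compact_Times M_compact compact_Icc)
    have h: "(\<lambda>p. ennreal (q \<epsilon> p)) \<in> borel_measurable (restrict_space borel M)" using q_meas[of \<epsilon>] by simp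
    have h\<mu>: "(\<lambda>p. ennreal (q \<epsilon> p)) \<in> borel_measurable \<mu>" using meas_\<mu>[OF q_meas[of \<epsilon>]] by simp
    \<comment> \<open>Although \<mu> comes from the single height \<delta>, its chart densities do
      not remember it. Weighting by \<open>q \<epsilon>\<close> gives the chart densities of the
      tube measure of height \<epsilon>, and uniqueness identifies the two.\<close>
    have "density \<mu> (\<lambda>p. ennreal (q \<epsilon> p)) = \<nu> \<epsilon>"
    proof (rule measure_eqI_oriented_charts)
      fix U \<phi> A assume op: "oriented_param M \<eta> U \<phi>" and A: "A \<in> sets borel" "A \<subseteq> U"
      have lp: "local_param M U \<phi>" and pos: "\<And>u. u \<in> U \<Longrightarrow> area_density \<eta> \<phi> u > 0"
        using op unfolding oriented_param_def by auto
      have "emeasure (density \<mu> (\<lambda>p. ennreal (q \<epsilon> p))) (\<phi> ` A) = (\<integral>\<^sup>+p\<in>\<phi> ` A. ennreal (q \<epsilon> p) \<partial>\<mu>)"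
        using h\<mu> chart_image_borel[OF lp A] \<mu>_sets by (intro emeasure_density) auto
      also have "\<dots> = (\<integral>\<^sup>+u\<in>A. ennreal (q \<epsilon> (\<phi> u)) * ennreal (area_density \<eta> \<phi> u) \<partial>lborel)"
        by (intro transfer[OF \<mu>_sets op A cont(1)[OF lp] _ h] \<mu>_chart[OF op])
      also have "\<dots> = (\<integral>\<^sup>+u\<in>A. ennreal (area_density \<eta> \<phi> u * q \<epsilon> (\<phi> u)) \<partial>lborel)"
      proof (rule nn_integral_cong)
        fix u
        show "ennreal (q \<epsilon> (\<phi> u)) * ennreal (area_density \<eta> \<phi> u) * indicator A u
          = ennreal (area_density \<eta> \<phi> u * q \<epsilon> (\<phi> u)) * indicator A u"
          using pos[of u] A(2) by (auto split: split_indicator simp: ennreal_mult' mult.commute)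
      qed
      also have "\<dots> = emeasure (\<nu> \<epsilon>) (\<phi> ` A)" by (rule \<nu>_chart[OF \<epsilon> op A, symmetric])
      finally show "emeasure (density \<mu> (\<lambda>p. ennreal (q \<epsilon> p))) (\<phi> ` A) = emeasure (\<nu> \<epsilon>) (\<phi> ` A)" .
    qed (use \<mu>_sets \<nu>_sets[OF \<epsilon>(2)] in auto)
    then have "emeasure (\<nu> \<epsilon>) M = (\<integral>\<^sup>+p\<in>M. ennreal (q \<epsilon> p) \<partial>\<mu>)"
      using emeasure_density[OF h\<mu>, of M] M_sets \<mu>_sets by simp
    also have "\<dots> = (\<integral>\<^sup>+p. ennreal (q \<epsilon> p) \<partial>\<mu>)"
      by (intro nn_integral_cong) (simp add: space_\<mu>)
    finally show "emeasure lebesgue (tube N M \<epsilon>) = (\<integral>\<^sup>+p. ennreal (q \<epsilon> p) \<partial>\<mu>)"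
      using \<nu>[OF \<epsilon>(2) M_sets] tube_eq[OF \<epsilon>(1)] by simp
  qed
  \<comment> \<open>The tube of radius \<delta> has finite volume and its weight is at least
    4\<delta>/3, which bounds the area.\<close>
  have fin: "emeasure \<mu> M < \<infinity>"
  proof -
    have "ennreal (4 * \<delta> / 3) * emeasure \<mu> M = (\<integral>\<^sup>+p. ennreal (4 * \<delta> / 3) \<partial>\<mu>)" by (simp add: space_\<mu>)
    also have "\<dots> \<le> (\<integral>\<^sup>+p. ennreal (q \<delta> p) \<partial>\<mu>)"
      using q_ge[OF \<delta>(1) order_refl] by (intro nn_integral_mono ennreal_leI) (simp add: space_\<mu>)
    also have "\<dots> < \<infinity>"
      using tube[OF \<delta>(1) order_refl] by (metis emeasure_eq_measure2 ennreal_less_top infinity_ennreal_def)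
    finally show ?thesis using \<delta>(1) by (auto simp: ennreal_mult_less_top)
  qed
  interpret finite_measure \<mu> by (rule finite_measureI) (use fin space_\<mu> in auto)
  \<comment> \<open>The bound on t^2 K, read at t = \<delta>, now provides integrability of the
    curvature.\<close>
  have "\<bar>curvature M \<eta> p\<bar> \<le> 1 / \<delta>\<^sup>2" if "p \<in> M" for p
    using \<delta>1(3)[OF that, of \<delta>] \<delta>(1,2) by (simp add: abs_mult field_simps)
  then have K_int: "integrable \<mu> (curvature M \<eta>)"
    by (intro integrable_const_bound[of _ "1 / \<delta>\<^sup>2"] meas_\<mu> K_meas) (auto simp: space_\<mu>)
  have "measure lebesgue (tube N M \<epsilon>) = 2 * \<epsilon> * measure \<mu> M + 2 * \<epsilon> ^ 3 / 3 * (\<integral>p. curvature M \<eta> p \<partial>\<mu>)"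
    if \<epsilon>: "0 < \<epsilon>" "\<epsilon> \<le> \<delta>" for \<epsilon>
  proof -
    have q_int: "integrable \<mu> (q \<epsilon>)" unfolding q_def using K_int by simp
    have q_nn: "0 \<le> q \<epsilon> p" if "p \<in> M" for p using q_ge[OF \<epsilon> that] \<epsilon>(1) by simp
    have "(\<integral>\<^sup>+p. ennreal (q \<epsilon> p) \<partial>\<mu>) = ennreal (\<integral>p. q \<epsilon> p \<partial>\<mu>)"
      using q_int q_nn by (intro nn_integral_eq_integral) (auto simp: space_\<mu>)
    moreover have "0 \<le> (\<integral>p. q \<epsilon> p \<partial>\<mu>)" using q_nn by (intro Bochner_Integration.integral_nonneg) (simp add: space_\<mu>)
    ultimately have "measure lebesgue (tube N M \<epsilon>) = (\<integral>p. q \<epsilon> p \<partial>\<mu>)"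
      using tube(2)[OF \<epsilon>] unfolding measure_def by simp
    also have "\<dots> = 2 * \<epsilon> * measure \<mu> M + 2 * \<epsilon> ^ 3 / 3 * (\<integral>p. curvature M \<eta> p \<partial>\<mu>)"
      unfolding q_def using K_int by (simp add: space_\<mu> mult.commute)
    finally show ?thesis .
  qed
  then show ?thesis unfolding area using \<delta>(1) tube(1) by (intro exI[of _ \<delta>]) auto
qed

end

theorem theorem3p1:
  fixes N :: "real^3 \<Rightarrow> real" and M :: "(real^3) set" and \<eta> :: "real^3 \<Rightarrow> real^3"
  assumes "is_norm N" and "smooth_norm N" and "strictly_convex_norm N"
    and "nonvanishing_gauss_curvature (unit_sphere N)"
    and "regular_surface M" and "compact M"
    and "birkhoff_gauss_map N M \<eta>"
  shows "\<exists>\<epsilon>\<^sub>0>0. \<forall>\<epsilon>. 0 < \<epsilon> \<and> \<epsilon> < \<epsilon>\<^sub>0 \<longrightarrow>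
    tube N M \<epsilon> \<in> lmeasurable \<and>
    measure lebesgue (tube N M \<epsilon>) =
      2 * \<epsilon> * measure (area_measure M \<eta>) M
      + 2 * \<epsilon> ^ 3 / 3 * (\<integral>p. curvature M \<eta> p \<partial>area_measure M \<eta>)"
proof -
  interpret minkowski_surface N M \<eta>
    using assms by unfold_locales
  show ?thesis by (rule tube_volume)
qed

end
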